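(* For an American option $\xi$ and $j\in\{1,\ldots,d\}$, \[ \pi^{\mathrm{ag}}_j(\xi)=\max_{\chi\in\mathcal{X}}\ \max_{(\mathbb{Q},S)\in\bar{\mathcal{P}}^{\mathrm{d}}_j(\chi)}\mathbb{E}_{\mathbb{Q}}\big((\xi\cdot S)_\chi\big), \] and there exist $\hat\chi\in\mathcal{X}$ and $(\hat{\mathbb{Q}},\hat S)\in\bar{\mathcal{P}}^{\mathrm{d}}_j(\hat\chi)$ with $\pi^{\mathrm{ag}}_j(\xi)=\mathbb{E}_{\hat{\mathbb{Q}}}((\xi\cdot\hat S)_{\hat\chi})$.
   Context: Finite filtered probability space $(\Omega,\mathcal{F},\mathbb{P};(\mathcal{F}_t)_{t=0}^T)$, $\mathcal{F}_0$ trivial, $\mathcal{F}_T=2^\Omega$, $\mathbb{P}(\{\omega\})>0$. $\Omega_t$: atoms of $\mathcal{F}_t$. $\mathcal{L}_t$: $\mathcal{F}_t$-measurable $\mathbb{R}^d$-valued random variables. $d$ assets, $\mathcal{F}_t$-measurable exchange rates $\pi^{jk}_t>0$, $\pi^{jj}_t=1$. $\mathcal{K}^\mu_t$ ($\mu\in\Omega_t$): convex cone generated by $e^1,\ldots,e^d$ and $\pi^{jk}_t(\mu)e^j-e^k$; $\mathcal{K}_t=\{x\in\mathcal{L}_t:x(\mu)\in\mathcal{K}^\mu_t\ \forall\mu\}$. Deferred solvency cone $\mathcal{Q}_t$: $z\in\mathcal{L}_t$ for which there are $y_{t+1},\ldots,y_{T+1}$, $y_s\in\mathcal{L}_{s-1}$,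 $y_{T+1}=0$, $z-y_{t+1}\in\mathcal{K}_t$, $y_s-y_{s+1}\in\mathcal{K}_s$ ($s>t$); $\mathcal{Q}^\mu_t=\{z(\mu):z\in\mathcal{Q}_t\}$. $A^\ast=\{y:y\cdot x\ge0\ \forall x\in A\}$ for a cone $A$; "$X\in\mathcal{Q}^\ast_t$" means $X(\mu)\in(\mathcal{Q}^\mu_t)^\ast$ for all $\mu\in\Omega_t$. Trading strategies $\Phi$: $y_0\in\mathbb{R}^d$, $y_t\in\mathcal{L}_{t-1}$, $y_{T+1}=0$. Mixed stopping times $\mathcal{X}$: adapted $[0,1]$-valued $\chi$ with $\sum_t\chi_t=1$. For adapted $X$: $X^{\chi\ast}_t=\sum_{s=t}^T\chi_sX_s$, $X^{\chi\ast}_{T+1}=0$, $X_\chi=\sum_{s=0}^T\chi_sX_s$; $(\xi\cdot S)_t=\xi_t\cdot S_t$. American option: adapted $\mathbb{R}^d$-valued $\xi$. $\Phi^{\mathrm{ag}}(\xi)$: maps $Y:\mathcal{X}\to\Phi$ with $Y^\chi_t-\chi_t\xi_t-Y^\chi_{t+1}\in\mathcal{K}_t$ for $t=0,\ldots,T$ and non-anticipating ($\chi_s(\omega)=\chi'_s(\omega)$ for $s<t$ implies $Y^\chi_t(\omega)=Y^{\chi'}_t(\omega)$); $Y_0$ is the common initial value. $\pi^{\mathrm{ag}}_j(\xi)=\inf\{x\in\mathbb{R}:\exists Y\in\Phi^{\mathrm{ag}}(\xi),xe^j=Y_0\}$. For $\chi\in\mathcal{X}$, $\bar{\mathcal{P}}^{\mathrm{d}}(\chi)$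 is the set of pairs $(\mathbb{Q},S)$ with $\mathbb{Q}$ a probability measure on $\Omega$ and $S$ an $\mathbb{R}^d$-valued adapted process such that $S_t\in\mathcal{Q}^\ast_t\setminus\{0\}$ and $\mathbb{E}_{\mathbb{Q}}(S^{\chi\ast}_{t+1}|\mathcal{F}_t)\in\mathcal{Q}^\ast_t$ for each $t=0,\ldots,T$; $\bar{\mathcal{P}}^{\mathrm{d}}_j(\chi)$ is the subset with $S^j_t=1$ for all $t$. Standing assumption: no arbitrage (no $y\in\Phi$ with $y_0=0$, $y_t-y_{t+1}\in\mathcal{K}_t$ for $t<T$ and $y_T-x\in\mathcal{K}_T$ for a nonzero componentwise non-negative $x\in\mathcal{L}_T$). *)

theory Defs
  imports "HOL-Analysis.Analysis"
begin

text \<open>Finite filtered probability space: the sample space is the finite type 'w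
 (every point has positive probability; the reference measure plays no further role).
 The filtration is given by its atoms: atom t w is the atom of F_t containing w.
 Assets are indexed by the finite type 'd, so R^d is real^'d.
 rate t w j k is the exchange rate rate^{jk}_t(w).\<close>

definition filtration :: "nat \<Rightarrow> (nat \<Rightarrow> 'w::finite \<Rightarrow> 'w set) \<Rightarrow> bool" where
  "filtration T atom \<longleftrightarrow>
     (\<forall>t w. w \<in> atom t w) \<and>
     (\<forall>t w w'. w' \<in> atom t w \<longrightarrow> atom t w' = atom t w) \<and>
     (\<forall>t s w. t \<le> s \<and> s \<le> T \<longrightarrow> atom s w \<subseteq> atom t w) \<and>
     (\<forall>w. atom 0 w = UNIV) \<and>
     (\<forall>w. atom T w = {w})"

definition meas :: "(nat \<Rightarrow> 'w \<Rightarrow> 'w set) \<Rightarrow> nat \<Rightarrow> ('w \<Rightarrow> 'b) \<Rightarrow> bool" where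
  "meas atom t X \<longleftrightarrow> (\<forall>w w'. w' \<in> atom t w \<longrightarrow> X w' = X w)"

definition adapted :: "nat \<Rightarrow> (nat \<Rightarrow> 'w \<Rightarrow> 'w set) \<Rightarrow> (nat \<Rightarrow> 'w \<Rightarrow> 'b) \<Rightarrow> bool" where
  "adapted T atom X \<longleftrightarrow> (\<forall>t\<le>T. meas atom t (X t))"

definition exchange_rates ::
  "nat \<Rightarrow> (nat \<Rightarrow> 'w \<Rightarrow> 'w set) \<Rightarrow> (nat \<Rightarrow> 'w \<Rightarrow> 'd::finite \<Rightarrow> 'd \<Rightarrow> real) \<Rightarrow> bool" where
  "exchange_rates T atom rate \<longleftrightarrow>
     (\<forall>t\<le>T. \<forall>w j k. rate t w j k > 0) \<and> (\<forall>t\<le>T. \<forall>w j. rate t w j j = 1) \<and>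
     (\<forall>t\<le>T. \<forall>j k. meas atom t (\<lambda>w. rate t w j k))"

text \<open>Solvency cone K^mu_t (evaluated at a point w of the atom mu).\<close>
definition Kcone :: "(nat \<Rightarrow> 'w \<Rightarrow> 'd::finite \<Rightarrow> 'd \<Rightarrow> real) \<Rightarrow> nat \<Rightarrow> 'w \<Rightarrow> (real^'d) set" where
  "Kcone rate t w = convex_cone hull
     ({axis i 1 | i. True} \<union> {rate t w j k *\<^sub>R axis j 1 - axis k 1 | j k. True})"

definition Qset :: "nat \<Rightarrow> (nat \<Rightarrow> 'w::finite \<Rightarrow> 'w set) \<Rightarrow> (nat \<Rightarrow> 'w \<Rightarrow> 'd::finite \<Rightarrow> 'd \<Rightarrow> real)
    \<Rightarrow> nat \<Rightarrow> ('w \<Rightarrow> real^'d) set" where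
  "Qset T atom rate t = {z. meas atom t z \<and>
     (\<exists>y :: nat \<Rightarrow> 'w \<Rightarrow> real^'d.
        (\<forall>s\<in>{t+1..T+1}. meas atom (s - 1) (y s)) \<and> y (T+1) = (\<lambda>_. 0) \<and>
        (\<forall>w. z w - y (t+1) w \<in> Kcone rate t w) \<and>
        (\<forall>s\<in>{t+1..T}. \<forall>w. y s w - y (s+1) w \<in> Kcone rate s w))}"

definition Qcone :: "nat \<Rightarrow> (nat \<Rightarrow> 'w::finite \<Rightarrow> 'w set) \<Rightarrow> (nat \<Rightarrow> 'w \<Rightarrow> 'd::finite \<Rightarrow> 'd \<Rightarrow> real)
    \<Rightarrow> nat \<Rightarrow> 'w \<Rightarrow> (real^'d) set" where
  "Qcone T atom rate t w = {z w | z. z \<in> Qset T atom rate t}"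

definition dual_cone :: "(real^'d::finite) set \<Rightarrow> (real^'d) set" where
  "dual_cone A = {y. \<forall>x\<in>A. y \<bullet> x \<ge> 0}"

definition strategy :: "nat \<Rightarrow> (nat \<Rightarrow> 'w \<Rightarrow> 'w set) \<Rightarrow> (nat \<Rightarrow> 'w \<Rightarrow> real^'d::finite) \<Rightarrow> bool" where
  "strategy T atom y \<longleftrightarrow> (\<forall>w w'. y 0 w = y 0 w') \<and>
     (\<forall>t\<in>{1..T}. meas atom (t - 1) (y t)) \<and> y (T+1) = (\<lambda>_. 0)"

definition no_arbitrage :: "nat \<Rightarrow> (nat \<Rightarrow> 'w::finite \<Rightarrow> 'w set) \<Rightarrow> (nat \<Rightarrow> 'w \<Rightarrow> 'd::finite \<Rightarrow> 'd \<Rightarrow> real) \<Rightarrow> bool" where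
  "no_arbitrage T atom rate \<longleftrightarrow> \<not> (\<exists>y x. strategy T atom y \<and> (\<forall>w. y 0 w = 0) \<and>
     (\<forall>t<T. \<forall>w. y t w - y (t+1) w \<in> Kcone rate t w) \<and>
     meas atom T x \<and> (\<forall>w i. x w $ i \<ge> 0) \<and> x \<noteq> (\<lambda>_. 0) \<and>
     (\<forall>w. y T w - x w \<in> Kcone rate T w))"

definition mixed_stopping :: "nat \<Rightarrow> (nat \<Rightarrow> 'w \<Rightarrow> 'w set) \<Rightarrow> (nat \<Rightarrow> 'w \<Rightarrow> real) \<Rightarrow> bool" where
  "mixed_stopping T atom ch \<longleftrightarrow> adapted T atom ch \<and>
     (\<forall>t\<le>T. \<forall>w. 0 \<le> ch t w \<and> ch t w \<le> 1) \<and> (\<forall>w. (\<Sum>t\<le>T. ch t w) = 1) \<and>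
     (\<forall>t>T. \<forall>w. ch t w = 0)"

definition Phi_ag :: "nat \<Rightarrow> (nat \<Rightarrow> 'w::finite \<Rightarrow> 'w set) \<Rightarrow> (nat \<Rightarrow> 'w \<Rightarrow> 'd::finite \<Rightarrow> 'd \<Rightarrow> real)
    \<Rightarrow> (nat \<Rightarrow> 'w \<Rightarrow> real^'d) \<Rightarrow> ((nat \<Rightarrow> 'w \<Rightarrow> real) \<Rightarrow> nat \<Rightarrow> 'w \<Rightarrow> real^'d) set" where
  "Phi_ag T atom rate \<xi> = {Y.
     (\<forall>ch. mixed_stopping T atom ch \<longrightarrow> strategy T atom (Y ch)) \<and>
     (\<forall>ch. mixed_stopping T atom ch \<longrightarrow> (\<forall>t\<le>T. \<forall>w.
        Y ch t w - ch t w *\<^sub>R \<xi> t w - Y ch (t+1) w \<in> Kcone rate t w)) \<and>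
     (\<forall>ch ch'. mixed_stopping T atom ch \<longrightarrow> mixed_stopping T atom ch' \<longrightarrow>
        (\<forall>t\<le>T+1. \<forall>w. (\<forall>s<t. ch s w = ch' s w) \<longrightarrow> Y ch t w = Y ch' t w))}"

definition ask_price_set :: "nat \<Rightarrow> (nat \<Rightarrow> 'w::finite \<Rightarrow> 'w set) \<Rightarrow> (nat \<Rightarrow> 'w \<Rightarrow> 'd::finite \<Rightarrow> 'd \<Rightarrow> real)
    \<Rightarrow> (nat \<Rightarrow> 'w \<Rightarrow> real^'d) \<Rightarrow> 'd \<Rightarrow> real set" where
  "ask_price_set T atom rate \<xi> j = {x. \<exists>Y\<in>Phi_ag T atom rate \<xi>.
      \<forall>ch. mixed_stopping T atom ch \<longrightarrow> (\<forall>w. Y ch 0 w = x *\<^sub>R axis j 1)}"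

definition ask_price :: "nat \<Rightarrow> (nat \<Rightarrow> 'w::finite \<Rightarrow> 'w set) \<Rightarrow> (nat \<Rightarrow> 'w \<Rightarrow> 'd::finite \<Rightarrow> 'd \<Rightarrow> real)
    \<Rightarrow> (nat \<Rightarrow> 'w \<Rightarrow> real^'d) \<Rightarrow> 'd \<Rightarrow> real" where
  "ask_price T atom rate \<xi> j = Inf (ask_price_set T atom rate \<xi> j)"

definition prob_fun :: "('w::finite \<Rightarrow> real) \<Rightarrow> bool" where
  "prob_fun q \<longleftrightarrow> (\<forall>w. q w \<ge> 0) \<and> (\<Sum>w\<in>UNIV. q w) = 1"

text \<open>Conditional expectation E_Q(X | F_t), evaluated at w (set to 0 on Q-null atoms,
 where it is only determined up to a null set).\<close>
definition cond_exp :: "('w::finite \<Rightarrow> real) \<Rightarrow> (nat \<Rightarrow> 'w \<Rightarrow> 'w set) \<Rightarrow> nat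
    \<Rightarrow> ('w \<Rightarrow> real^'d::finite) \<Rightarrow> 'w \<Rightarrow> real^'d" where
  "cond_exp q atom t X w =
     (let m = (\<Sum>v\<in>atom t w. q v) in
      if m = 0 then 0 else (1 / m) *\<^sub>R (\<Sum>v\<in>atom t w. q v *\<^sub>R X v))"

definition stopped_tail :: "nat \<Rightarrow> (nat \<Rightarrow> 'w \<Rightarrow> real) \<Rightarrow> (nat \<Rightarrow> 'w \<Rightarrow> real^'d::finite)
    \<Rightarrow> nat \<Rightarrow> 'w \<Rightarrow> real^'d" where
  "stopped_tail T ch X t w = (\<Sum>s\<in>{t..T}. ch s w *\<^sub>R X s w)"

definition Pd :: "nat \<Rightarrow> (nat \<Rightarrow> 'w::finite \<Rightarrow> 'w set) \<Rightarrow> (nat \<Rightarrow> 'w \<Rightarrow> 'd::finite \<Rightarrow> 'd \<Rightarrow> real)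
    \<Rightarrow> (nat \<Rightarrow> 'w \<Rightarrow> real) \<Rightarrow> (('w \<Rightarrow> real) \<times> (nat \<Rightarrow> 'w \<Rightarrow> real^'d)) set" where
  "Pd T atom rate ch = {(q, S). prob_fun q \<and> adapted T atom S \<and>
     (\<forall>t\<le>T. \<forall>w. S t w \<in> dual_cone (Qcone T atom rate t w) - {0}) \<and>
     (\<forall>t\<le>T. \<forall>w. cond_exp q atom t (stopped_tail T ch S (t+1)) w
                    \<in> dual_cone (Qcone T atom rate t w))}"

definition Pd_j :: "nat \<Rightarrow> (nat \<Rightarrow> 'w::finite \<Rightarrow> 'w set) \<Rightarrow> (nat \<Rightarrow> 'w \<Rightarrow> 'd::finite \<Rightarrow> 'd \<Rightarrow> real)
    \<Rightarrow> (nat \<Rightarrow> 'w \<Rightarrow> real) \<Rightarrow> 'd \<Rightarrow> (('w \<Rightarrow> real) \<times> (nat \<Rightarrow> 'w \<Rightarrow> real^'d)) set" where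
  "Pd_j T atom rate ch j = {(q, S) \<in> Pd T atom rate ch. \<forall>t\<le>T. \<forall>w. S t w $ j = 1}"

definition exp_payoff :: "nat \<Rightarrow> ('w::finite \<Rightarrow> real) \<Rightarrow> (nat \<Rightarrow> 'w \<Rightarrow> real)
    \<Rightarrow> (nat \<Rightarrow> 'w \<Rightarrow> real^'d::finite) \<Rightarrow> (nat \<Rightarrow> 'w \<Rightarrow> real^'d) \<Rightarrow> real" where
  "exp_payoff T q ch \<xi> S = (\<Sum>w\<in>UNIV. q w * (\<Sum>t\<le>T. ch t w * (\<xi> t w \<bullet> S t w)))"

end

theory Submission
  imports Defs
begin

text \<open>By linearity it suffices for the seller to be able to survive exercise in full at any single
  time: \<open>x\<close> superhedges \<open>\<xi>\<close> iff some self-financing \<open>y\<close> starts from \<open>x\<close> units of asset \<open>j\<close> and satisfies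
  \<open>y\<^sub>t - \<xi>\<^sub>t \<in> \<Q>\<^sub>t\<close> for all \<open>t\<close>.  The ask price is therefore the value of a finite linear program.  Farkas'
  lemma provides multipliers \<open>B\<^sub>t\<close> of the exercise constraints such that \<open>B\<^sub>t\<close> and the conditional
  expectations of \<open>\<Sum>\<^sub>s\<^sub>>\<^sub>t B\<^sub>s\<close> lie in \<open>\<Q>\<^sub>t\<^sup>*\<close>.  Splitting the adapted process \<open>B\<^sup>j\<close> of total mass 1 as
  a probability times a mixed stopping time, and putting \<open>S\<^sub>t = B\<^sub>t / B\<^sub>t\<^sup>j\<close> (or any consistent price where
  \<open>B\<^sub>t = 0\<close>), turns the multipliers into a maximiser.\<close>

section \<open>Farkas' lemma\<close>

text \<open>The obstacle is attainment: neither the infimum over hedges nor the maximum over prices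
  comes with compactness, and \<open>Qcone\<close> is a projection with no generators at hand. So
  the deferral paths themselves become variables of the program; the only cones left are the
  \<open>Kcone\<close>s, which have finitely many explicit generators, and multipliers exist without
  any limit argument. Duality with \<open>Qcone\<close> is regained afterwards by inserting test
  paths into the multiplier identity.

  Scaling the payoff by a variable \<open>r\<close> puts the price, known only as an infimum, into a
  linear implication; its case \<open>r = 0\<close> concerns recession directions. No arbitrage acts
  through one fact: \<open>Qcone\<close> contains no nonzero vector with all components nonpositive.
  By separation each dual cone then contains a vector with \<open>j\<close>-th component 1. Such
  vectors bound the price below, give the sign of \<open>r\<close>, settle \<open>r = 0\<close>, and
  later fill in \<open>S\<close> where the multiplier vanishes.\<close>

lemma convex_cone_hull_finite_halfspaces:
  fixes G :: "'a::euclidean_space set"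
  assumes "finite G"
  obtains H where "finite H" "convex_cone hull G = {v. \<forall>h\<in>H. 0 \<le> h \<bullet> v}"
proof -
  let ?K = "convex_cone hull G"
  obtain F where F: "finite F" "?K = \<Inter>F"
    and "\<forall>h\<in>F. \<exists>a b. a \<noteq> 0 \<and> h = {x. a \<bullet> x \<le> b}"
    using polyhedron_convex_cone_hull[OF assms] unfolding polyhedron_def by blast
  then have half: "\<forall>h\<in>F. \<exists>p. h = {x. fst p \<bullet> x \<le> snd p}"
    by simp blast
  obtain p where p: "\<And>h. h \<in> F \<Longrightarrow> h = {x. fst (p h) \<bullet> x \<le> snd (p h)}"
    using bchoice[OF half] by blast
  define a b where "a = fst \<circ> p" and "b = snd \<circ> p"
  have ab: "h = {x. a h \<bullet> x \<le> b h}" if "h \<in> F" for h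
    using p[OF that] by (simp add: a_def b_def)
  \<comment> \<open>A positive value of \<open>a h\<close> on the cone could be scaled past
    \<open>b h\<close>. As 0 lies in the cone, \<open>b h\<close> is nonnegative, so every bound
    \<open>b h\<close> may be replaced by 0.\<close>
  have neg: "a h \<bullet> v \<le> 0" if "h \<in> F" "v \<in> ?K" for h v
  proof (rule ccontr)
    assume "\<not> a h \<bullet> v \<le> 0"
    then have pos: "a h \<bullet> v > 0" by simp
    define c where "c = (\<bar>b h\<bar> + 1) / (a h \<bullet> v)"
    have "c *\<^sub>R v \<in> ?K"
      using that(2) pos by (intro convex_cone_hull_mul) (simp_all add: c_def)
    then have "a h \<bullet> (c *\<^sub>R v) \<le> b h"
      using F(2) ab that(1) by blast
    then show False
      using pos by (simp add: c_def)
  qed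
  have nonneg: "0 \<le> b h" if "h \<in> F" for h
  proof -
    have "0 \<in> h" using convex_cone_hull_contains_0[of G] F(2) that by blast
    then have "0 \<in> {x. a h \<bullet> x \<le> b h}" using ab[OF that] by simp
    then show ?thesis by simp
  qed
  have "?K = {v. \<forall>h\<in>(\<lambda>h. - a h) ` F. 0 \<le> h \<bullet> v}"
  proof (intro equalityI subsetI)
    fix v assume "v \<in> {v. \<forall>h\<in>(\<lambda>h. - a h) ` F. 0 \<le> h \<bullet> v}"
    then have "v \<in> h" if "h \<in> F" for h
      using ab[OF that] nonneg[OF that] that by fastforce
    then show "v \<in> ?K" using F(2) by blast
  qed (use neg in auto)
  then show ?thesis
    by (rule that[OF finite_imageI[OF F(1)]])
qed

text \<open>Bartl's induction: if the forms indexed by \<open>I\<close> do not already imply \<open>g\<close>, some \<open>x\<^sub>0\<close> violates the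
  implication and has \<open>f m x\<^sub>0 < 0\<close> for the new index \<open>m\<close>; then project along \<open>x\<^sub>0\<close> onto the
  kernel of \<open>f m\<close>.\<close>
lemma farkas:
  fixes f :: "'i \<Rightarrow> 'v \<Rightarrow> real" and g :: "'v \<Rightarrow> real"
  assumes "finite I"
    and "\<And>x y r. x \<in> D \<Longrightarrow> y \<in> D \<Longrightarrow>
      \<exists>z\<in>D. g z = g x + r * g y \<and> (\<forall>i\<in>I. f i z = f i x + r * f i y)"
    and "\<And>x. x \<in> D \<Longrightarrow> \<forall>i\<in>I. 0 \<le> f i x \<Longrightarrow> 0 \<le> g x"
  shows "\<exists>l. (\<forall>i\<in>I. 0 \<le> l i) \<and> (\<forall>x\<in>D. g x = (\<Sum>i\<in>I. l i * f i x))"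
  using assms
proof (induction I arbitrary: D rule: finite_induct)
  case (empty D)
  have "g x = 0" if x: "x \<in> D" for x
  proof -
    \<comment> \<open>Combining \<open>x\<close> with itself for \<open>r = -2\<close> gives a point
      of value \<open>- g x\<close>, so \<open>g x\<close> is nonnegative and nonpositive.\<close>
    obtain z where "z \<in> D" "g z = g x + (-2) * g x"
      using empty.prems(1)[OF x x, of "-2"] by blast
    moreover from this have "0 \<le> g z" using empty.prems(2)[of z] by simp
    ultimately show ?thesis
      using empty.prems(2)[of x] x by simp
  qed
  then show ?case by simp
next
  case (insert m I D)
  show ?case
  proof (cases "\<forall>x\<in>D. (\<forall>i\<in>I. 0 \<le> f i x) \<longrightarrow> 0 \<le> g x")
    case True
    have "\<exists>l. (\<forall>i\<in>I. 0 \<le> l i) \<and> (\<forall>x\<in>D. g x = (\<Sum>i\<in>I. l i * f i x))"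
    proof (rule insert.IH)
      fix x y r assume "x \<in> D" "y \<in> D"
      from insert.prems(1)[OF this, of r]
      show "\<exists>z\<in>D. g z = g x + r * g y \<and> (\<forall>i\<in>I. f i z = f i x + r * f i y)" by blast
    qed (use True in blast)
    then obtain l where l: "\<forall>i\<in>I. 0 \<le> l i" "\<forall>x\<in>D. g x = (\<Sum>i\<in>I. l i * f i x)" by blast
    have "(\<Sum>i\<in>insert m I. (l(m := 0)) i * f i x) = (\<Sum>i\<in>I. l i * f i x)" for x
      using insert.hyps by (auto intro!: sum.cong)
    with l show ?thesis
      by (intro exI[of _ "l(m := 0)"]) auto
  next
    case False
    then obtain x0 where x0: "x0 \<in> D" "\<forall>i\<in>I. 0 \<le> f i x0" "g x0 < 0" by force
    have m0: "f m x0 < 0"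
      using insert.prems(2)[OF x0(1)] x0(2,3) by force
    define D' where "D' = {x\<in>D. f m x = 0}"
    have "\<exists>l. (\<forall>i\<in>I. 0 \<le> l i) \<and> (\<forall>x\<in>D'. g x = (\<Sum>i\<in>I. l i * f i x))"
    proof (rule insert.IH)
      fix x y r assume xy: "x \<in> D'" "y \<in> D'"
      then obtain z where "z \<in> D" "g z = g x + r * g y"
        "\<forall>i\<in>insert m I. f i z = f i x + r * f i y"
        using insert.prems(1)[of x y r] unfolding D'_def by blast
      then show "\<exists>z\<in>D'. g z = g x + r * g y \<and> (\<forall>i\<in>I. f i z = f i x + r * f i y)"
        using xy by (auto simp: D'_def)
    qed (use insert.prems(2) in \<open>auto simp: D'_def\<close>)
    then obtain l where l: "\<forall>i\<in>I. 0 \<le> l i" "\<forall>x\<in>D'. g x = (\<Sum>i\<in>I. l i * f i x)" by blast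
    let ?s = "\<lambda>x. \<Sum>i\<in>I. l i * f i x"
    \<comment> \<open>The only value for which the extended identity holds at \<open>x0\<close>;
      numerator and denominator are both negative.\<close>
    define c where "c = (g x0 - ?s x0) / f m x0"
    have "0 \<le> ?s x0"
      using l(1) x0(2) by (intro sum_nonneg) auto
    then have c: "0 \<le> c"
      using m0 x0(3) by (simp add: c_def divide_nonpos_neg)
    have "g x = ?s x + c * f m x" if x: "x \<in> D" for x
    proof -
      let ?r = "- f m x / f m x0"
      obtain z where z: "z \<in> D" "g z = g x + ?r * g x0"
        "\<forall>i\<in>insert m I. f i z = f i x + ?r * f i x0"
        using insert.prems(1)[OF x x0(1), of ?r] by blast
      have "z \<in> D'"
        using z m0 by (simp add: D'_def)
      then have "g z = ?s z"
        using l(2) by blast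
      also have "\<dots> = ?s x + ?r * ?s x0"
      proof -
        have "?s z = (\<Sum>i\<in>I. l i * f i x + ?r * (l i * f i x0))"
        proof (rule sum.cong)
          fix i assume "i \<in> I"
          then have "f i z = f i x + ?r * f i x0" using z(3) by blast
          then show "l i * f i z = l i * f i x + ?r * (l i * f i x0)"
            by (simp only: distrib_left mult.left_commute)
        qed simp
        then show ?thesis by (simp only: sum.distrib sum_distrib_left)
      qed
      finally show ?thesis
        using z(2) m0 by (simp add: c_def field_simps)
    qed
    moreover have "(\<Sum>i\<in>insert m I. (l(m := c)) i * f i x) = c * f m x + ?s x" for x
      using insert.hyps by (auto intro!: sum.cong)
    ultimately show ?thesis
      using l(1) c by (intro exI[of _ "l(m := c)"]) auto
  qed
qed

text \<open>Membership in a finitely generated cone is a finite set of scalar inequalities, so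
  \<open>farkas\<close> applies with one form for each pair of a constraint and a half-space normal;
  \<open>a i\<close> sums the normals weighted by their multipliers. \<open>D\<close> is a mere set,
  and \<open>comb\<close> speaks only of the values of \<open>g\<close> and \<open>F\<close>, which
  admits tuples of processes as variables.\<close>

lemma conic_farkas:
  fixes F :: "'i \<Rightarrow> 'v \<Rightarrow> 'a::euclidean_space" and g :: "'v \<Rightarrow> real"
  assumes "finite I" and "\<And>i. i \<in> I \<Longrightarrow> finite (G i)"
    and comb: "\<And>x y r. x \<in> D \<Longrightarrow> y \<in> D \<Longrightarrow>
      \<exists>z\<in>D. g z = g x + r * g y \<and> (\<forall>i\<in>I. F i z = F i x + r *\<^sub>R F i y)"
    and imp: "\<And>x. x \<in> D \<Longrightarrow> \<forall>i\<in>I. F i x \<in> convex_cone hull G i \<Longrightarrow> 0 \<le> g x"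
  shows "\<exists>a. (\<forall>i\<in>I. \<forall>v\<in>convex_cone hull G i. 0 \<le> a i \<bullet> v) \<and>
    (\<forall>x\<in>D. g x = (\<Sum>i\<in>I. a i \<bullet> F i x))"
proof -
  have "\<forall>i\<in>I. \<exists>H. finite H \<and> convex_cone hull G i = {v. \<forall>h\<in>H. 0 \<le> h \<bullet> v}"
  proof
    fix i assume "i \<in> I"
    show "\<exists>H. finite H \<and> convex_cone hull G i = {v. \<forall>h\<in>H. 0 \<le> h \<bullet> v}"
      by (rule convex_cone_hull_finite_halfspaces[OF assms(2)[OF \<open>i \<in> I\<close>]]) blast
  qed
  from bchoice[OF this] obtain H where H: "\<And>i. i \<in> I \<Longrightarrow> finite (H i)"
    "\<And>i. i \<in> I \<Longrightarrow> convex_cone hull G i = {v. \<forall>h\<in>H i. 0 \<le> h \<bullet> v}"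
    by blast
  let ?J = "Sigma I H"
  have "\<exists>l. (\<forall>p\<in>?J. 0 \<le> l p) \<and>
      (\<forall>x\<in>D. g x = (\<Sum>p\<in>?J. l p * (case p of (i, h) \<Rightarrow> h \<bullet> F i x)))"
  proof (rule farkas)
    show "finite ?J" using assms(1) H(1) by blast
  next
    fix x y r assume "x \<in> D" "y \<in> D"
    from comb[OF this, of r] show "\<exists>z\<in>D. g z = g x + r * g y \<and>
        (\<forall>p\<in>?J. (case p of (i, h) \<Rightarrow> h \<bullet> F i z) =
          (case p of (i, h) \<Rightarrow> h \<bullet> F i x) + r * (case p of (i, h) \<Rightarrow> h \<bullet> F i y))"
      by (fastforce simp: inner_simps)
  next
    fix x assume "x \<in> D" "\<forall>p\<in>?J. 0 \<le> (case p of (i, h) \<Rightarrow> h \<bullet> F i x)"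
    then show "0 \<le> g x" using imp[of x] H(2) by auto
  qed
  then obtain l where l: "\<forall>p\<in>?J. 0 \<le> l p"
    "\<forall>x\<in>D. g x = (\<Sum>p\<in>?J. l p * (case p of (i, h) \<Rightarrow> h \<bullet> F i x))" by blast
  define a where "a i = (\<Sum>h\<in>H i. l (i, h) *\<^sub>R h)" for i
  have "0 \<le> a i \<bullet> v" if "i \<in> I" "v \<in> convex_cone hull G i" for i v
    using that l(1) H(2)[of i] by (auto simp: a_def inner_sum_left intro!: sum_nonneg)
  moreover have "g x = (\<Sum>i\<in>I. a i \<bullet> F i x)" if "x \<in> D" for x
    using that l(2) assms(1) H(1)
    by (simp add: a_def inner_sum_left sum.Sigma split_beta)
  ultimately show ?thesis by blast
qed

section \<open>Finite filtrations and mixed stopping times\<close>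

locale finite_filtration =
  fixes T :: nat and atom :: "nat \<Rightarrow> 'w::finite \<Rightarrow> 'w set"
  assumes filtration: "filtration T atom"
begin

lemma atom_self [simp]: "w \<in> atom t w"
  using filtration by (simp add: filtration_def)

lemma atom_eq: "v \<in> atom t w \<Longrightarrow> atom t v = atom t w"
  using filtration by (simp add: filtration_def)

lemma atom_mono: "t \<le> s \<Longrightarrow> s \<le> T \<Longrightarrow> atom s w \<subseteq> atom t w"
  using filtration by (simp add: filtration_def)

lemma atom_0 [simp]: "atom 0 w = UNIV"
  using filtration by (simp add: filtration_def)

lemma atom_T [simp]: "atom T w = {w}"
  using filtration by (simp add: filtration_def)

lemma meas_mono: "meas atom t X \<Longrightarrow> t \<le> s \<Longrightarrow> s \<le> T \<Longrightarrow> meas atom s X"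
  using atom_mono unfolding meas_def by blast

lemma atom_iff: "v \<in> atom s u \<Longrightarrow> t \<le> s \<Longrightarrow> s \<le> T \<Longrightarrow> v \<in> atom t w \<longleftrightarrow> u \<in> atom t w"
  by (metis atom_eq atom_mono atom_self subsetD)

text \<open>The atoms of the later time \<open>s\<close> partition an atom of time \<open>t\<close>,
  so identities of sums pass from finer to coarser atoms.\<close>

lemma sum_atom_refine:
  fixes f g :: "'w \<Rightarrow> 'b::comm_monoid_add"
  assumes "t \<le> s" "s \<le> T" and "\<And>u. u \<in> atom t w \<Longrightarrow> sum f (atom s u) = sum g (atom s u)"
  shows "sum f (atom t w) = sum g (atom t w)"
proof -
  let ?P = "atom s ` atom t w"
  have "\<Union>?P = atom t w"
    using assms(1,2) by (auto simp: atom_iff)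
  moreover have "A \<inter> B = {}" if "A \<in> ?P" "B \<in> ?P" "A \<noteq> B" for A B
    using that by (auto dest: atom_eq)
  then have "sum h (\<Union>?P) = sum (sum h) ?P" for h :: "'w \<Rightarrow> 'b"
    by (subst sum.Union_disjoint) auto
  moreover have "sum (sum f) ?P = sum (sum g) ?P"
    using assms(3) by (auto intro: sum.cong[OF refl])
  ultimately show ?thesis by metis
qed

text \<open>Conditional expectation under the uniform measure. It will make the multipliers adapted
  while keeping their sums over atoms.\<close>

definition atom_average :: "nat \<Rightarrow> ('w \<Rightarrow> 'b) \<Rightarrow> 'w \<Rightarrow> 'b::real_vector" where
  "atom_average t f w = (1 / card (atom t w)) *\<^sub>R sum f (atom t w)"

lemma meas_atom_average: "meas atom t (atom_average t f)"
  by (simp add: meas_def atom_average_def atom_eq)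

lemma sum_atom_average: "sum (atom_average t f) (atom t w) = sum f (atom t w)"
proof -
  have "card (atom t w) \<noteq> 0"
    using atom_self[of w t] by (metis card_0_eq empty_iff finite)
  moreover have "sum (atom_average t f) (atom t w) = (\<Sum>v\<in>atom t w. atom_average t f w)"
    using meas_atom_average[of t f] by (intro sum.cong) (auto simp: meas_def)
  ultimately show ?thesis
    by (simp add: atom_average_def sum_constant_scaleR)
qed

lemma sum_UNIV_eq_of_atoms:
  fixes f g :: "'w \<Rightarrow> 'b::comm_monoid_add"
  assumes "t \<le> T" "\<And>w. sum f (atom t w) = sum g (atom t w)"
  shows "sum f UNIV = sum g UNIV"
  using sum_atom_refine[of 0 t undefined f g] assms by simp

lemma sum_nonneg_of_atoms:
  fixes f :: "'w \<Rightarrow> real"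
  assumes "t \<le> T" "\<And>w. 0 \<le> sum f (atom t w)"
  shows "0 \<le> sum f UNIV"
proof -
  have "sum f UNIV = sum (atom_average t f) UNIV"
    by (rule sum_UNIV_eq_of_atoms[OF assms(1)]) (simp add: sum_atom_average)
  also have "0 \<le> \<dots>"
    using assms(2) by (intro sum_nonneg) (simp add: atom_average_def)
  finally show ?thesis .
qed

text \<open>\<open>h t\<close> distributes an atom of time \<open>t\<close> in proportion to the \<open>b\<close>-mass still to come after \<open>t\<close>
  (uniformly if there is none), and iterating these kernels gives \<open>q\<close>; at time \<open>t\<close> the fraction \<open>rho t\<close>,
  the share of \<open>b t\<close> in the mass from \<open>t\<close> on, of the unexercised rest is exercised.\<close>
lemma mixed_stopping_decomposition:
  fixes b :: "nat \<Rightarrow> 'w \<Rightarrow> real"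
  assumes nonneg: "\<And>t w. t \<le> T \<Longrightarrow> 0 \<le> b t w"
    and total: "(\<Sum>w\<in>UNIV. \<Sum>t\<le>T. b t w) = 1"
  obtains q ch where "prob_fun q" "mixed_stopping T atom ch"
    "\<And>t w. t \<le> T \<Longrightarrow> (\<Sum>v\<in>atom t w. q v * ch t v) = (\<Sum>v\<in>atom t w. b t v)"
proof -
  define tail where "tail t w = (\<Sum>s\<in>{t..T}. b s w)" for t w
  have tail_Suc: "tail t w = b t w + tail (Suc t) w" if "t \<le> T" for t w
    using that by (simp add: tail_def sum.atLeast_Suc_atMost)
  define M where "M t w = (\<Sum>v\<in>atom t w. tail (Suc t) v)" for t w
  define N where "N t w = (\<Sum>v\<in>atom t w. tail t v)" for t w
  define m where "m t w = (\<Sum>v\<in>atom t w. b t v)" for t w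
  define h where "h t v = (if M t v = 0 then 1 / card (atom t v) else tail (Suc t) v / M t v)" for t v
  \<comment> \<open>\<open>p t\<close> has the final masses on atoms of times up to
    \<open>t\<close>: each step keeps the mass of an atom of time \<open>t\<close> and redistributes
    it inside. The start supplies the total mass 1.\<close>
  define p where "p = rec_nat (\<lambda>_. 1 / CARD('w)) (\<lambda>t pt w. (\<Sum>v\<in>atom t w. pt v) * h t w)"
  \<comment> \<open>Exercising everything at \<open>T\<close>, and whenever no mass is left, makes
    \<open>rest (Suc T)\<close> vanish, so that \<open>ch\<close> sums to 1 on every path, even on
    one of probability 0.\<close>
  define rho where "rho t w = (if N t w = 0 \<or> t = T then 1 else m t w / N t w)" for t w
  define rest where "rest t w = (\<Prod>s<t. 1 - rho s w)" for t w
  define ch where "ch t w = (if t \<le> T then rest t w * rho t w else 0)" for t w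
  have tail0: "0 \<le> tail t w" for t w
    unfolding tail_def by (intro sum_nonneg) (auto simp: nonneg)
  have M0: "0 \<le> M t w" and N0: "0 \<le> N t w" for t w
    by (simp_all add: M_def N_def tail0 sum_nonneg)
  have m0: "0 \<le> m t w" if "t \<le> T" for t w
    using that by (simp add: m_def nonneg sum_nonneg)
  have N_eq: "N t w = m t w + M t w" if "t \<le> T" for t w
    using that by (simp add: N_def m_def M_def tail_Suc sum.distrib)
  have N_T: "N T w = m T w" for w
    by (simp add: N_def m_def tail_def)
  have p_0: "p 0 w = 1 / CARD('w)" and p_Suc: "p (Suc t) w = (\<Sum>v\<in>atom t w. p t v) * h t w" for t w
    by (simp_all add: p_def)
  have h_sum: "(\<Sum>v\<in>atom t w. h t v) = 1" for t w
  proof -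
    have "(\<Sum>v\<in>atom t w. h t v) =
      (\<Sum>v\<in>atom t w. if M t w = 0 then 1 / card (atom t w) else tail (Suc t) v / M t w)"
      by (rule sum.cong) (auto simp: h_def M_def atom_eq)
    also have "\<dots> = 1"
    proof (cases "M t w = 0")
      case True
      have "card (atom t w) \<noteq> 0" using atom_self[of w t] by (metis card_0_eq empty_iff finite)
      then show ?thesis using True by simp
    next
      case False
      then show ?thesis by (simp add: M_def flip: sum_divide_distrib)
    qed
    finally show ?thesis .
  qed
  have p_atom_Suc: "(\<Sum>v\<in>atom t w. p (Suc t) v) = (\<Sum>v\<in>atom t w. p t v)" for t w
  proof -
    have "(\<Sum>v\<in>atom t w. p (Suc t) v) = (\<Sum>v\<in>atom t w. (\<Sum>u\<in>atom t w. p t u) * h t v)"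
      by (rule sum.cong) (auto simp: p_Suc atom_eq)
    then show ?thesis
      by (simp add: h_sum flip: sum_distrib_left)
  qed
  have p_atom: "(\<Sum>v\<in>atom t w. p s v) = (\<Sum>v\<in>atom t w. p t v)" if "t \<le> s" "s \<le> Suc T" for t s w
    using that
  proof (induction s rule: dec_induct)
    case (step s)
    have "(\<Sum>v\<in>atom t w. p (Suc s) v) = (\<Sum>v\<in>atom t w. p s v)"
      using step by (intro sum_atom_refine[of t s]) (auto simp: p_atom_Suc)
    then show ?case using step by simp
  qed simp
  have h0: "0 \<le> h t v" for t v
    by (simp add: h_def tail0 M0)
  have p0: "0 \<le> p t w" for t w
    by (induction t arbitrary: w) (auto simp: p_0 p_Suc h0 intro!: mult_nonneg_nonneg sum_nonneg)
  define q where "q = p T"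
  have q_atom: "(\<Sum>v\<in>atom t w. q v) = (\<Sum>v\<in>atom t w. p t v)" if "t \<le> T" for t w
    using p_atom[of t T] that by (simp add: q_def)
  have prob: "prob_fun q"
    using q_atom[of 0] p0 by (simp add: prob_fun_def q_def p_0)
  have rho01: "0 \<le> rho t w \<and> rho t w \<le> 1" if "t \<le> T" for t w
  proof (cases "N t w = 0 \<or> t = T")
    case False
    then have "0 < N t w" using N0[of t w] by simp
    then show ?thesis
      using False N_eq[OF that, of w] m0[OF that, of w] M0[of t w] by (simp add: rho_def field_simps)
  qed (simp add: rho_def)
  have rest01: "0 \<le> rest t w \<and> rest t w \<le> 1" if "t \<le> T" for t w
    unfolding rest_def using rho01 that by (auto intro!: prod_nonneg prod_le_1)
  have rho_meas: "rho t v = rho t w" if "v \<in> atom t w" for t v w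
    using atom_eq[OF that] by (simp add: rho_def N_def m_def)
  have rest_meas: "rest t v = rest t w" if "v \<in> atom t w" "t \<le> T" for t v w
    unfolding rest_def
  proof (rule prod.cong)
    fix s assume "s \<in> {..<t}"
    then have "v \<in> atom s w" using that atom_mono[of s t w] by auto
    then show "1 - rho s v = 1 - rho s w" by (simp add: rho_meas)
  qed simp
  have partial: "(\<Sum>s<t. ch s w) = 1 - rest t w" if "t \<le> Suc T" for t w
    using that by (induction t) (auto simp: rest_def ch_def algebra_simps)
  have "rest (Suc T) w = 0" for w
    by (simp add: rest_def rho_def)
  then have sum1: "(\<Sum>t\<le>T. ch t w) = 1" for w
    using partial[of "Suc T" w] by (simp add: lessThan_Suc_atMost)
  have mixed: "mixed_stopping T atom ch"
    unfolding mixed_stopping_def adapted_def meas_def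
    using rho01 rest01 sum1 rho_meas rest_meas
    by (auto simp: ch_def intro: mult_le_one)
  \<comment> \<open>The invariant: probability of the atom times unexercised share is the
    \<open>b\<close>-mass from \<open>t\<close> on. Exercise removes \<open>m\<close>, and
    \<open>h\<close> splits the remaining \<open>M\<close> among the next atoms.\<close>
  have key: "(\<Sum>v\<in>atom t w. p t v) * rest t w = N t w" if "t \<le> T" for t w
    using that
  proof (induction t)
    case 0
    have "(\<Sum>v\<in>UNIV. p 0 v) = 1" by (simp add: p_0)
    then show ?case using total by (simp add: rest_def N_def tail_def atLeast0AtMost)
  next
    case (Suc t)
    have IH: "(\<Sum>v\<in>atom t w. p t v) * rest t w = N t w" using Suc by simp
    have tT: "t < T" using Suc by simp
    have sub: "atom (Suc t) w \<subseteq> atom t w" using Suc atom_mono[of t "Suc t"] by simp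
    have Mv: "M t v = M t w" if "v \<in> atom (Suc t) w" for v
      using atom_eq[of v t w] that sub by (auto simp: M_def)
    \<comment> \<open>Covers \<open>M t w = 0\<close>, where \<open>h\<close> is uniform by default:
      then \<open>N (Suc t) w\<close> is 0 as well.\<close>
    have NM: "N (Suc t) w \<le> M t w"
      unfolding N_def M_def using sub by (intro sum_mono2) (auto simp: tail0)
    have rest_Suc: "rest (Suc t) w = rest t w * (1 - rho t w)" by (simp add: rest_def)
    have "(\<Sum>v\<in>atom (Suc t) w. p (Suc t) v) =
        (\<Sum>v\<in>atom (Suc t) w. (\<Sum>u\<in>atom t w. p t u) * h t v)"
    proof (rule sum.cong)
      fix v assume "v \<in> atom (Suc t) w"
      then have "atom t v = atom t w" using sub by (intro atom_eq) blast
      then show "p (Suc t) v = (\<Sum>u\<in>atom t w. p t u) * h t v" by (simp add: p_Suc)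
    qed simp
    then have "(\<Sum>v\<in>atom (Suc t) w. p (Suc t) v) * rest (Suc t) w =
        N t w * (1 - rho t w) * (\<Sum>v\<in>atom (Suc t) w. h t v)"
      by (simp add: rest_Suc IH[symmetric] flip: sum_distrib_left)
    also have "N t w * (1 - rho t w) = M t w"
    proof (cases "N t w = 0")
      case True
      then show ?thesis using tT N_eq[of t w] m0[of t w] M0[of t w] by simp
    next
      case False
      then have "N t w * (1 - rho t w) = N t w - m t w"
        using tT by (simp add: rho_def right_diff_distrib)
      then show ?thesis using tT N_eq[of t w] by simp
    qed
    also have "M t w * (\<Sum>v\<in>atom (Suc t) w. h t v) = N (Suc t) w"
    proof (cases "M t w = 0")
      case True
      then show ?thesis using NM N0[of "Suc t" w] by simp
    next
      case False
      have "(\<Sum>v\<in>atom (Suc t) w. h t v) = (\<Sum>v\<in>atom (Suc t) w. tail (Suc t) v / M t w)"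
      proof (rule sum.cong)
        fix v assume "v \<in> atom (Suc t) w"
        from Mv[OF this] False show "h t v = tail (Suc t) v / M t w" by (simp add: h_def)
      qed simp
      then show ?thesis using False by (simp add: N_def flip: sum_divide_distrib)
    qed
    finally show ?case .
  qed
  show ?thesis
  proof (rule that[OF prob mixed])
    fix t w assume t: "t \<le> T"
    have "(\<Sum>v\<in>atom t w. q v * ch t v) = (\<Sum>v\<in>atom t w. q v) * (rest t w * rho t w)"
      unfolding sum_distrib_right using t
      by (intro sum.cong) (auto simp: ch_def rho_meas rest_meas)
    also have "\<dots> = N t w * rho t w"
      using key[OF t] q_atom[OF t] by simp
    also have "\<dots> = m t w"
      using N_eq[OF t, of w] N_T m0[OF t, of w] M0[of t w] by (auto simp: rho_def)
    finally show "(\<Sum>v\<in>atom t w. q v * ch t v) = (\<Sum>v\<in>atom t w. b t v)"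
      by (simp add: m_def)
  qed
qed

end

section \<open>Deferred solvency cones\<close>

lemma finite_Kcone_generators:
  fixes rate :: "nat \<Rightarrow> 'w \<Rightarrow> 'd::finite \<Rightarrow> 'd \<Rightarrow> real"
  shows "finite ({axis i 1 | i. True} \<union> {rate t w j k *\<^sub>R axis j 1 - axis k 1 | j k. True} :: (real^'d) set)"
  using finite_image_set2[of "\<lambda>_. True" "\<lambda>_. True" "\<lambda>j k. rate t w j k *\<^sub>R axis j 1 - axis k (1::real)"]
  by (simp add: full_SetCompr_eq)

lemma Kcone_0 [simp]: "0 \<in> Kcone rate t w"
  by (simp add: Kcone_def convex_cone_hull_contains_0)

lemma Kcone_add: "x \<in> Kcone rate t w \<Longrightarrow> y \<in> Kcone rate t w \<Longrightarrow> x + y \<in> Kcone rate t w"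
  unfolding Kcone_def by (rule convex_cone_hull_add)

lemma Kcone_scaleR: "x \<in> Kcone rate t w \<Longrightarrow> 0 \<le> c \<Longrightarrow> c *\<^sub>R x \<in> Kcone rate t w"
  unfolding Kcone_def by (rule convex_cone_hull_mul)

lemma Kcone_sum: "(\<And>i. i \<in> A \<Longrightarrow> f i \<in> Kcone rate t w) \<Longrightarrow> sum f A \<in> Kcone rate t w"
  by (induction A rule: infinite_finite_induct) (auto intro: Kcone_add)

lemma Kcone_axis [simp]: "axis i 1 \<in> Kcone rate t w"
  unfolding Kcone_def by (rule hull_inc) blast

lemma Kcone_exchange: "rate t w j k *\<^sub>R axis j 1 - axis k 1 \<in> Kcone rate t w"
  unfolding Kcone_def by (rule hull_inc) blast

lemma Kcone_nonneg:
  fixes x :: "real^'d::finite"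
  assumes "\<And>i. 0 \<le> x $ i"
  shows "x \<in> Kcone rate t w"
proof -
  have "x = (\<Sum>i\<in>UNIV. (x $ i) *\<^sub>R axis i 1)"
    by (simp add: vec_eq_iff axis_def if_distrib cong: if_cong)
  also have "\<dots> \<in> Kcone rate t w"
    by (intro Kcone_sum Kcone_scaleR assms) simp
  finally show ?thesis .
qed

lemma dual_cone_scaleR: "x \<in> dual_cone A \<Longrightarrow> 0 \<le> c \<Longrightarrow> c *\<^sub>R x \<in> dual_cone A"
  by (simp add: dual_cone_def)

locale currency_market = finite_filtration T atom
  for T and atom :: "nat \<Rightarrow> 'w::finite \<Rightarrow> 'w set" +
  fixes rate :: "nat \<Rightarrow> 'w \<Rightarrow> 'd::finite \<Rightarrow> 'd \<Rightarrow> real"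
  assumes rates: "exchange_rates T atom rate"
    and no_arb: "no_arbitrage T atom rate"
begin

abbreviation "K \<equiv> Kcone rate"
abbreviation "Q \<equiv> Qcone T atom rate"
abbreviation "restrict_atom t w X \<equiv> (\<lambda>v. if v \<in> atom t w then X v else 0)"

lemma Kcone_atom: "v \<in> atom t w \<Longrightarrow> t \<le> T \<Longrightarrow> K t v = K t w"
  using rates by (simp add: exchange_rates_def meas_def Kcone_def)

text \<open>An atom of time \<open>t\<close> is a union of atoms of each later time, so a process
  may be switched on there alone. This localises global test processes to one atom.\<close>

lemma meas_restrict_atom:
  assumes "meas atom s X" "t \<le> s" "s \<le> T"
  shows "meas atom s (restrict_atom t w X)"
  using assms(1) atom_iff[OF _ assms(2,3), of _ _ w] unfolding meas_def by auto

text \<open>The position \<open>z\<close> of \<open>Qset\<close> is stored as \<open>y t\<close>, so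
  that the first increment has the same form as the later ones.\<close>

definition deferral :: "nat \<Rightarrow> (nat \<Rightarrow> 'w \<Rightarrow> real^'d) \<Rightarrow> bool" where
  "deferral t y \<longleftrightarrow> meas atom t (y t) \<and> (\<forall>s\<in>{Suc t..Suc T}. meas atom (s - 1) (y s)) \<and>
     y (Suc T) = (\<lambda>_. 0) \<and> (\<forall>s\<in>{t..T}. \<forall>w. y s w - y (Suc s) w \<in> K s w)"

lemma Qset_iff_deferral:
  assumes "t \<le> T"
  shows "z \<in> Qset T atom rate t \<longleftrightarrow> (\<exists>y. deferral t y \<and> y t = z)"
proof
  assume "z \<in> Qset T atom rate t"
  then obtain y where y: "meas atom t z" "\<forall>s\<in>{t+1..T+1}. meas atom (s - 1) (y s)" "y (T+1) = (\<lambda>_. 0)"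
      "\<forall>w. z w - y (t+1) w \<in> K t w" "\<forall>s\<in>{t+1..T}. \<forall>w. y s w - y (s+1) w \<in> K s w"
    unfolding Qset_def by blast
  have "deferral t (y(t := z))"
    using y assms unfolding deferral_def by (auto simp: Suc_le_eq)
  then show "\<exists>y. deferral t y \<and> y t = z"
    by (intro exI[of _ "y(t := z)"]) simp
next
  assume "\<exists>y. deferral t y \<and> y t = z"
  then show "z \<in> Qset T atom rate t"
    using assms unfolding Qset_def deferral_def by fastforce
qed

lemma Qset_meas: "z \<in> Qset T atom rate t \<Longrightarrow> meas atom t z"
  by (simp add: Qset_def)

lemma Qset_imp_Qcone: "z \<in> Qset T atom rate t \<Longrightarrow> z w \<in> Q t w"
  by (auto simp: Qcone_def)

lemma meas_add: "meas atom t x \<Longrightarrow> meas atom t y \<Longrightarrow> meas atom t (\<lambda>w. x w + y w)"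
  and meas_diff: "meas atom t x \<Longrightarrow> meas atom t y \<Longrightarrow> meas atom t (\<lambda>w. x w - y w)"
  for x y :: "'w \<Rightarrow> real^'d"
  by (simp_all add: meas_def)

lemma meas_scaleR: "meas atom t c \<Longrightarrow> meas atom t x \<Longrightarrow> meas atom t (\<lambda>w. c w *\<^sub>R x w)"
  for x :: "'w \<Rightarrow> real^'d"
  by (simp add: meas_def)

lemma meas_const [simp]: "meas atom t (\<lambda>_. c)"
  by (simp add: meas_def)

lemma deferral_add:
  assumes "deferral t x" "deferral t y"
  shows "deferral t (\<lambda>s w. x s w + y s w)"
  using assms unfolding deferral_def
  by (auto simp: add_diff_add intro: meas_add Kcone_add)

lemma deferral_scaleR:
  assumes "deferral t x" "0 \<le> c"
  shows "deferral t (\<lambda>s w. c *\<^sub>R x s w)"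
  using assms unfolding deferral_def
  by (auto intro: meas_scaleR Kcone_scaleR simp flip: scaleR_diff_right)

lemma convex_cone_Qcone:
  assumes "t \<le> T"
  shows "convex_cone (Q t w)"
proof -
  have Q: "z \<in> Q t w \<longleftrightarrow> (\<exists>y. deferral t y \<and> z = y t w)" for z
    using Qset_iff_deferral[OF assms] by (auto simp: Qcone_def)
  have "deferral t (\<lambda>_ _. 0)"
    by (simp add: deferral_def)
  then have "0 \<in> Q t w"
    unfolding Q by fastforce
  moreover have "x + y \<in> Q t w" if "x \<in> Q t w" "y \<in> Q t w" for x y
    using that deferral_add unfolding Q by fast
  moreover have "c *\<^sub>R x \<in> Q t w" if "x \<in> Q t w" "0 \<le> c" for x c
    using that deferral_scaleR unfolding Q by fast
  ultimately show ?thesis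
    unfolding convex_cone_iff by blast
qed

lemma Qcone_atom: "v \<in> atom t w \<Longrightarrow> Q t v = Q t w"
proof -
  assume "v \<in> atom t w"
  then have "z v = z w" if "z \<in> Qset T atom rate t" for z
    using Qset_meas[OF that] by (simp add: meas_def)
  then show ?thesis
    unfolding Qcone_def Setcompr_eq_image by (rule image_cong[OF refl])
qed

lemma Qset_of_Kcone:
  assumes "t \<le> T" "meas atom t z" "\<And>w. z w \<in> K t w"
  shows "z \<in> Qset T atom rate t"
proof -
  have "deferral t (\<lambda>s. if s = t then z else (\<lambda>_. 0))"
    using assms by (auto simp: deferral_def)
  then show ?thesis
    unfolding Qset_iff_deferral[OF assms(1)] by fastforce
qed

lemma Kcone_subset_Qcone:
  assumes "t \<le> T"
  shows "K t w \<subseteq> Q t w"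
proof
  fix x assume x: "x \<in> K t w"
  have "restrict_atom t w (\<lambda>_. x) v \<in> K t v" for v
    using assms x Kcone_atom[of v t w] by simp
  then have "restrict_atom t w (\<lambda>_. x) \<in> Qset T atom rate t"
    using assms by (intro Qset_of_Kcone meas_restrict_atom) simp_all
  from Qset_imp_Qcone[OF this, of w] show "x \<in> Q t w" by simp
qed

lemma dual_Qcone_nonneg:
  assumes "t \<le> T" "S \<in> dual_cone (Q t w)"
  shows "x \<in> K t w \<Longrightarrow> 0 \<le> S \<bullet> x"
  using assms Kcone_subset_Qcone unfolding dual_cone_def by blast

lemma dual_Qcone_components:
  assumes "t \<le> T" "S \<in> dual_cone (Q t w)"
  shows "0 \<le> S $ k" "S $ k \<le> rate t w j k * S $ j"
  using dual_Qcone_nonneg[OF assms, of "axis k 1"]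
    dual_Qcone_nonneg[OF assms Kcone_exchange, of j k]
  by (simp_all add: inner_axis inner_diff_right)

text \<open>Every asset can be bought with asset \<open>j\<close>, so component \<open>j\<close>
  bounds all others up to a factor. Hence nonzero dual vectors can be normalised in
  \<open>j\<close>.\<close>

lemma dual_Qcone_eq_0:
  assumes "t \<le> T" "S \<in> dual_cone (Q t w)" "S $ j = 0"
  shows "S = 0"
proof -
  have "S $ k = 0" for k
    using dual_Qcone_components(1)[OF assms(1,2), of k] dual_Qcone_components(2)[OF assms(1,2), of k j]
      assms(3) by simp
  then show ?thesis by (simp add: vec_eq_iff)
qed

text \<open>No arbitrage enters here. On the atom, split the position 0 at time \<open>t\<close>
  into \<open>x\<close> and \<open>- x\<close>: the part \<open>x\<close> is unwound at no cost, and
  the nonnegative part \<open>- x\<close> is left over at \<open>T\<close>.\<close>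

lemma Qcone_nonpos_eq_0:
  assumes t: "t \<le> T" and x: "x \<in> Q t w" "\<And>i. x $ i \<le> 0"
  shows "x = 0"
proof (rule ccontr)
  assume "x \<noteq> 0"
  obtain y where y: "deferral t y" "y t w = x"
    using x(1) Qset_iff_deferral[OF t] by (auto simp: Qcone_def)
  have yt: "y t v = x" if "v \<in> atom t w" for v
    using y that unfolding deferral_def meas_def by blast
  have step: "y s v - y (Suc s) v \<in> K s v" if "t \<le> s" "s \<le> T" for s v
    using y(1) that by (simp add: deferral_def)
  have end0: "y (Suc T) = (\<lambda>_. 0)"
    using y(1) by (simp add: deferral_def)
  \<comment> \<open>For \<open>t = T\<close> this is the zero strategy, and the gain comes from the
    solvency of \<open>x\<close> itself at \<open>T\<close>.\<close>
  define Y where "Y s = (if t < s \<and> s \<le> T then restrict_atom t w (\<lambda>v. y s v - x) else (\<lambda>_. 0))" for s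
  let ?X = "restrict_atom t w (\<lambda>_. - x)"
  have "strategy T atom Y"
    unfolding strategy_def
  proof (intro conjI allI ballI)
    fix s assume s: "s \<in> {1..T}"
    show "meas atom (s - 1) (Y s)"
    proof (cases "t < s")
      case True
      then have "meas atom (s - 1) (y s)"
        using y(1) s by (simp add: deferral_def)
      then show ?thesis
        using True s by (auto simp: Y_def intro!: meas_restrict_atom meas_diff)
    qed (simp add: Y_def)
  qed (auto simp: Y_def)
  moreover have "Y s v - Y (Suc s) v \<in> K s v" if "s < T" for s v
    using that step[of s v] yt[of v] by (cases "s = t") (auto simp: Y_def)
  moreover have "Y T v - ?X v \<in> K T v" for v
    using step[of T v] yt[of v] t end0 by (cases "t = T") (auto simp: Y_def)
  moreover have "?X \<noteq> (\<lambda>_. 0)"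
    using \<open>x \<noteq> 0\<close> by (auto dest: fun_cong[of _ _ w])
  moreover have "meas atom T ?X"
    using t by (intro meas_restrict_atom) simp_all
  moreover have "0 \<le> ?X v $ i" for v i
    using x(2) by simp
  moreover have "\<forall>v. Y 0 v = 0"
    by (simp add: Y_def)
  ultimately show False
    using no_arb unfolding no_arbitrage_def Suc_eq_plus1[symmetric] by blast
qed

text \<open>The vector with all components -1 lies outside the convex cone. The normal of a weak
  separation is nonzero and, by scaling, dual; its component \<open>j\<close> is then
  positive.\<close>

lemma consistent_price_exists:
  assumes t: "t \<le> T"
  shows "\<exists>S\<in>dual_cone (Q t w). S $ j = 1"
proof -
  note cone = convex_cone_Qcone[OF t, of w]
  define u :: "real^'d" where "u = (\<chi> i. - 1)"
  have "u \<notin> Q t w"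
    using Qcone_nonpos_eq_0[OF t, of u w] by (auto simp: u_def vec_eq_iff)
  then obtain a b where a: "a \<noteq> 0" and u: "a \<bullet> u \<le> b" and b: "\<forall>z\<in>Q t w. b \<le> a \<bullet> z"
    using separating_hyperplane_sets[of "{u}" "Q t w"] cone
    unfolding convex_cone_def by auto
  have "0 \<le> a \<bullet> z" if "z \<in> Q t w" for z
  proof (rule ccontr)
    assume "\<not> 0 \<le> a \<bullet> z"
    then have neg: "a \<bullet> z < 0" by simp
    define c where "c = (\<bar>b\<bar> + 1) / - (a \<bullet> z)"
    have "0 \<le> c" unfolding c_def using neg by (intro divide_nonneg_pos) simp_all
    then have "c *\<^sub>R z \<in> Q t w"
      by (rule convex_cone_scaleR[OF cone _ that])
    then have "b \<le> a \<bullet> (c *\<^sub>R z)"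
      using b by blast
    then show False using neg by (simp add: c_def)
  qed
  then have a_dual: "a \<in> dual_cone (Q t w)" by (simp add: dual_cone_def)
  then have pos: "0 < a $ j"
    using dual_Qcone_components(1)[OF t a_dual, of j] dual_Qcone_eq_0[OF t a_dual, of j] a by force
  then have "(1 / a $ j) *\<^sub>R a \<in> dual_cone (Q t w)"
    using a_dual by (intro dual_cone_scaleR) simp_all
  moreover have "((1 / a $ j) *\<^sub>R a) $ j = 1" using pos by simp
  ultimately show ?thesis by blast
qed

end

section \<open>Superhedging strategies\<close>

lemma mixed_stopping_meas: "mixed_stopping T atom ch \<Longrightarrow> t \<le> T \<Longrightarrow> meas atom t (ch t)"
  by (simp add: mixed_stopping_def adapted_def)

lemma mixed_stopping_nonneg: "mixed_stopping T atom ch \<Longrightarrow> t \<le> T \<Longrightarrow> 0 \<le> ch t w"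
  by (simp add: mixed_stopping_def)

lemma mixed_stopping_sum: "mixed_stopping T atom ch \<Longrightarrow> (\<Sum>t\<le>T. ch t w) = 1"
  by (simp add: mixed_stopping_def)

lemma mixed_stopping_deterministic:
  "s \<le> T \<Longrightarrow> mixed_stopping T atom (\<lambda>t w. if t = s then 1 else 0)"
  by (simp add: mixed_stopping_def adapted_def meas_def)

locale american_option = currency_market T atom rate
  for T and atom :: "nat \<Rightarrow> 'w::finite \<Rightarrow> 'w set"
    and rate :: "nat \<Rightarrow> 'w \<Rightarrow> 'd::finite \<Rightarrow> 'd \<Rightarrow> real" +
  fixes \<xi> :: "nat \<Rightarrow> 'w \<Rightarrow> real^'d" and j :: 'd
  assumes payoff: "adapted T atom \<xi>"
begin

text \<open>\<open>y t\<close> is the position while nothing has been exercised. The self-financing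
  condition stops before \<open>T\<close>, since what is left then is exercised, which the condition
  on \<open>Qset\<close> at \<open>T\<close> covers.\<close>

definition hedge :: "real \<Rightarrow> (nat \<Rightarrow> 'w \<Rightarrow> real^'d) \<Rightarrow> bool" where
  "hedge x y \<longleftrightarrow> (\<forall>w. y 0 w = x *\<^sub>R axis j 1) \<and> (\<forall>t\<in>{1..T}. meas atom (t - 1) (y t)) \<and>
     (\<forall>t<T. \<forall>w. y t w - y (Suc t) w \<in> K t w) \<and>
     (\<forall>t\<le>T. (\<lambda>w. y t w - \<xi> t w) \<in> Qset T atom rate t)"

lemma payoff_meas: "t \<le> T \<Longrightarrow> meas atom t (\<xi> t)"
  using payoff by (simp add: adapted_def)

lemma predictable_meas:
  assumes "\<And>w. y 0 w = c" "\<forall>t\<in>{1..T}. meas atom (t - 1) (y t)" "t \<le> T"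
  shows "meas atom t (y t)"
proof (cases "t = 0")
  case True
  then show ?thesis using assms(1) by (simp add: meas_def)
next
  case False
  then have "meas atom (t - 1) (y t)" using assms(2,3) by simp
  then show ?thesis by (rule meas_mono[OF _ _ assms(3)]) simp
qed

text \<open>Compare never exercising early with exercising everything at the fixed time \<open>t\<close>:
  non-anticipation makes both strategies agree up to \<open>t\<close>, and from then on the latter unwinds
  \<open>y t - \<xi> t\<close>.\<close>
lemma hedge_of_ask_price_set:
  assumes "x \<in> ask_price_set T atom rate \<xi> j"
  shows "\<exists>y. hedge x y"
proof -
  obtain Y where Y: "Y \<in> Phi_ag T atom rate \<xi>"
    and Y0: "\<And>ch w. mixed_stopping T atom ch \<Longrightarrow> Y ch 0 w = x *\<^sub>R axis j 1"
    using assms by (auto simp: ask_price_set_def)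
  have strat: "strategy T atom (Y ch)" if "mixed_stopping T atom ch" for ch
    using Y that unfolding Phi_ag_def by blast
  have step: "Y ch t w - ch t w *\<^sub>R \<xi> t w - Y ch (Suc t) w \<in> K t w"
    if "mixed_stopping T atom ch" "t \<le> T" for ch t w
    using Y that unfolding Phi_ag_def Suc_eq_plus1 by blast
  have nonant: "Y ch t w = Y ch' t w" if "mixed_stopping T atom ch" "mixed_stopping T atom ch'"
    "t \<le> T" "\<And>s. s < t \<Longrightarrow> ch s w = ch' s w" for ch ch' t w
  proof -
    have "t \<le> T + 1" "\<forall>s<t. ch s w = ch' s w" using that(3,4) by auto
    then show ?thesis using Y that(1,2) unfolding Phi_ag_def by blast
  qed
  define d where "d s = (\<lambda>t w::'w. if t = s then 1 else 0 :: real)" for s :: nat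
  have d: "mixed_stopping T atom (d s)" if "s \<le> T" for s
    using mixed_stopping_deterministic[OF that] by (simp add: d_def)
  define y where "y = Y (d T)"
  have y0: "y 0 w = x *\<^sub>R axis j 1" for w
    by (simp add: y_def Y0 d)
  have ym: "\<forall>t\<in>{1..T}. meas atom (t - 1) (y t)"
    using strat[OF d[of T]] by (simp add: strategy_def y_def)
  have "(\<lambda>w. y t w - \<xi> t w) \<in> Qset T atom rate t" if t: "t \<le> T" for t
  proof -
    \<comment> \<open>The payoff is already delivered at index \<open>t\<close>; the later positions
      are those of the strategy for exercise at \<open>t\<close>.\<close>
    let ?y = "(Y (d t))(t := \<lambda>w. y t w - \<xi> t w)"
    have eq: "Y (d t) t = y t"
      using t nonant[OF d d, of t T t] by (auto simp: y_def d_def)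
    have "meas atom t (\<lambda>w. y t w - \<xi> t w)"
      using predictable_meas[OF y0 ym t] payoff_meas[OF t] by (rule meas_diff)
    moreover have "y t w - \<xi> t w - Y (d t) (Suc t) w \<in> K t w" for w
      using step[OF d[OF t] t, of w] eq by (simp add: d_def)
    moreover have "Y (d t) s w - Y (d t) (Suc s) w \<in> K s w" if "s \<in> {Suc t..T}" for s w
      using step[OF d[OF t], of s w] that by (simp add: d_def)
    moreover have "meas atom (s - 1) (Y (d t) s)" if "s \<in> {Suc t..Suc T}" for s
      using strat[OF d[OF t]] that by (cases "s = Suc T") (auto simp: strategy_def)
    moreover have "Y (d t) (Suc T) = (\<lambda>_. 0)"
      using strat[OF d[OF t]] by (simp add: strategy_def)
    ultimately have "deferral t ?y"
      using t unfolding deferral_def by (auto simp: Suc_le_eq)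
    then show ?thesis
      unfolding Qset_iff_deferral[OF t] by (intro exI[of _ ?y]) simp
  qed
  moreover have "y t w - y (Suc t) w \<in> K t w" if "t < T" for t w
    using step[OF d[of T], of t w] that by (simp add: y_def d_def)
  ultimately show ?thesis
    using y0 ym unfolding hedge_def by blast
qed

text \<open>Each exercised fraction \<open>ch s\<close> is unwound separately along a deferral \<open>z s\<close> of \<open>y s - \<xi> s\<close>; the
  fraction not yet exercised follows \<open>y\<close>.\<close>
lemma ask_price_set_of_hedge:
  assumes "hedge x y"
  shows "x \<in> ask_price_set T atom rate \<xi> j"
proof -
  have y0: "y 0 w = x *\<^sub>R axis j 1" for w
    using assms by (simp add: hedge_def)
  have ym: "meas atom (t - 1) (y t)" if "t \<in> {1..T}" for t
    using assms that by (simp add: hedge_def)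
  have yK: "y t w - y (Suc t) w \<in> K t w" if "t < T" for t w
    using assms that by (simp add: hedge_def)
  have "\<forall>t\<in>{..T}. \<exists>z. deferral t z \<and> z t = (\<lambda>w. y t w - \<xi> t w)"
    using assms Qset_iff_deferral by (simp add: hedge_def)
  from bchoice[OF this] obtain z where
    z: "\<And>t. t \<le> T \<Longrightarrow> deferral t (z t)" and zt: "\<And>t. t \<le> T \<Longrightarrow> z t t = (\<lambda>w. y t w - \<xi> t w)"
    by auto
  \<comment> \<open>The strict bound \<open>s < t\<close> makes \<open>Y\<close> non-anticipating.
    \<open>hedge\<close> leaves \<open>y (T + 1)\<close> open, hence the explicit 0.\<close>
  define Y where "Y ch t w = (\<Sum>s<t. ch s w *\<^sub>R z s t w) +
      (1 - (\<Sum>s<t. ch s w)) *\<^sub>R (if t \<le> T then y t w else 0)" for ch t w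
  have Y0: "Y ch 0 w = x *\<^sub>R axis j 1" for ch w
    by (simp add: Y_def y0)
  have "Y \<in> Phi_ag T atom rate \<xi>"
    unfolding Phi_ag_def
  proof (intro CollectI conjI allI impI)
    fix ch assume ch: "mixed_stopping T atom ch"
    show "strategy T atom (Y ch)"
      unfolding strategy_def
    proof (intro conjI allI ballI)
      fix t assume t: "t \<in> {1..T}"
      have "meas atom (t - 1) (z s t)" if "s < t" for s
        using z[of s] t that unfolding deferral_def by auto
      moreover have "meas atom (t - 1) (ch s)" if "s < t" for s
        using mixed_stopping_meas[OF ch, of s] t that by (auto intro: meas_mono)
      ultimately show "meas atom (t - 1) (Y ch t)"
        using ym[OF t] t unfolding meas_def Y_def
        by (intro allI impI arg_cong2[of _ _ _ _ "(+)"] arg_cong2[of _ _ _ _ "(*\<^sub>R)"]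
            arg_cong2[of _ _ _ _ "(-)"] sum.cong) auto
    next
      have "z s (Suc T) = (\<lambda>_. 0)" if "s \<le> T" for s
        using z[OF that] by (simp add: deferral_def)
      then show "Y ch (T + 1) = (\<lambda>_. 0)"
        by (simp add: Y_def fun_eq_iff)
    qed (simp add: Y0)
  next
    fix ch t w assume ch: "mixed_stopping T atom ch" and t: "t \<le> T"
    let ?rest = "1 - (\<Sum>s<Suc t. ch s w)"
    let ?y = "if Suc t \<le> T then y (Suc t) w else 0"
    have "z s t w - z s (Suc t) w \<in> K t w" if "s \<le> t" for s
      using z[of s] that t by (simp add: deferral_def)
    then have 1: "(\<Sum>s<Suc t. ch s w *\<^sub>R (z s t w - z s (Suc t) w)) \<in> K t w"
      using t ch by (intro Kcone_sum Kcone_scaleR mixed_stopping_nonneg[of T atom]) auto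
    have 2: "?rest *\<^sub>R (y t w - ?y) \<in> K t w"
    proof (cases "t = T")
      case True
      then show ?thesis
        using mixed_stopping_sum[OF ch, of w] by (simp add: lessThan_Suc_atMost)
    next
      case False
      have "(\<Sum>s\<in>{..<Suc t}. ch s w) \<le> (\<Sum>s\<in>{..T}. ch s w)"
        using t by (intro sum_mono2) (auto intro!: mixed_stopping_nonneg[OF ch])
      then have "0 \<le> ?rest"
        using mixed_stopping_sum[OF ch, of w] by simp
      then show ?thesis
        using False t yK[of t w] by (intro Kcone_scaleR) auto
    qed
    \<comment> \<open>The summand \<open>s = t\<close> absorbs the delivery at \<open>t\<close>,
      because \<open>z t t\<close> is \<open>y t\<close> minus the payoff.\<close>
    have "Y ch t w - ch t w *\<^sub>R \<xi> t w - Y ch (Suc t) w =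
        (\<Sum>s<Suc t. ch s w *\<^sub>R (z s t w - z s (Suc t) w)) + ?rest *\<^sub>R (y t w - ?y)"
      using t by (simp add: Y_def zt scaleR_diff_right scaleR_diff_left scaleR_add_left sum_subtractf)
    then show "Y ch t w - ch t w *\<^sub>R \<xi> t w - Y ch (t + 1) w \<in> K t w"
      using Kcone_add[OF 1 2] by simp
  next
    fix ch ch' :: "nat \<Rightarrow> 'w \<Rightarrow> real" and t w assume "\<forall>s<t. ch s w = ch' s w"
    then show "Y ch t w = Y ch' t w"
      by (simp add: Y_def)
  qed
  then show ?thesis
    unfolding ask_price_set_def using Y0 by blast
qed

lemma ask_price_set_iff: "x \<in> ask_price_set T atom rate \<xi> j \<longleftrightarrow> (\<exists>y. hedge x y)"
  using hedge_of_ask_price_set ask_price_set_of_hedge by blast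

section \<open>Finiteness of the ask price\<close>

lemma hedge_exists: "\<exists>x y. hedge x y"
proof -
  \<comment> \<open>Bounds every payoff component, so \<open>c\<close> units of each asset cover any
    exercise in kind.\<close>
  define c where "c = (\<Sum>t\<le>T. \<Sum>w\<in>UNIV. \<Sum>i\<in>UNIV. \<bar>\<xi> t w $ i\<bar>)"
  have c: "\<xi> t w $ i \<le> c" if "t \<le> T" for t w i
  proof -
    have "\<bar>\<xi> t w $ i\<bar> \<le> (\<Sum>i\<in>UNIV. \<bar>\<xi> t w $ i\<bar>)"
      by (rule member_le_sum) auto
    also have "\<dots> \<le> (\<Sum>w\<in>UNIV. \<Sum>i\<in>UNIV. \<bar>\<xi> t w $ i\<bar>)"
      by (rule member_le_sum[where f = "\<lambda>w. \<Sum>i\<in>UNIV. \<bar>\<xi> t w $ i\<bar>"]) (auto intro: sum_nonneg)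
    also have "\<dots> \<le> c"
      unfolding c_def using that
      by (intro member_le_sum[where f = "\<lambda>t. \<Sum>w\<in>UNIV. \<Sum>i\<in>UNIV. \<bar>\<xi> t w $ i\<bar>"])
        (auto intro: sum_nonneg)
    finally show ?thesis by simp
  qed
  have c0: "0 \<le> c"
    by (simp add: c_def sum_nonneg)
  fix w0 :: 'w
  \<comment> \<open>The price in asset \<open>j\<close> of \<open>c\<close> units of every asset at
    time 0; rates at time 0 do not depend on \<open>w0\<close>.\<close>
  define x where "x = (\<Sum>k\<in>UNIV. c * rate 0 w0 j k)"
  let ?c = "(\<chi> i. c) :: real^'d"
  define y where "y t w = (if t = 0 then x *\<^sub>R axis j 1 else ?c)" for t :: nat and w :: 'w
  have "?c = (\<Sum>k\<in>UNIV. c *\<^sub>R axis k 1)"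
    by (simp add: vec_eq_iff axis_def if_distrib cong: if_cong)
  then have "x *\<^sub>R axis j 1 - ?c =
      (\<Sum>k\<in>UNIV. c *\<^sub>R (rate 0 w0 j k *\<^sub>R axis j 1 - axis k 1))"
    by (simp add: x_def scaleR_sum_left scaleR_diff_right sum_subtractf)
  also have "\<dots> \<in> K 0 w0"
    using c0 by (intro Kcone_sum Kcone_scaleR Kcone_exchange)
  finally have "x *\<^sub>R axis j 1 - ?c \<in> K 0 w" for w
    using Kcone_atom[of w 0 w0] by simp
  moreover have "?c - ?c \<in> K t w" for t w by simp
  ultimately have yc: "y t w - ?c \<in> K t w" for t w
    by (simp add: y_def)
  have "y t w - \<xi> t w \<in> K t w" if "t \<le> T" for t w
  proof -
    have "?c - \<xi> t w \<in> K t w"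
      using c[OF that] by (intro Kcone_nonneg) simp
    from Kcone_add[OF yc this] show ?thesis by simp
  qed
  moreover have "meas atom t (y s)" for t s
    by (simp add: y_def meas_def)
  moreover have "y t w - y (Suc t) w \<in> K t w" for t w
    using yc[of t w] by (simp add: y_def)
  ultimately have "hedge x y"
    unfolding hedge_def using payoff_meas
    by (auto intro!: Qset_of_Kcone meas_diff) (simp add: y_def)
  then show ?thesis by blast
qed

lemma hedge_lower_bound:
  assumes "hedge x y" "S \<in> dual_cone (Q 0 w)" "S $ j = 1"
  shows "S \<bullet> \<xi> 0 w \<le> x"
proof -
  have "y 0 w - \<xi> 0 w \<in> Q 0 w" "y 0 w = x *\<^sub>R axis j 1"
    using assms(1) Qset_imp_Qcone[of "\<lambda>w. y 0 w - \<xi> 0 w" 0 w] by (auto simp: hedge_def)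
  then have "0 \<le> S \<bullet> (x *\<^sub>R axis j 1 - \<xi> 0 w)"
    using assms(2) by (simp add: dual_cone_def)
  then show ?thesis
    using assms(3) by (simp add: inner_diff_right inner_axis)
qed

lemma ask_price_set_nonempty: "ask_price_set T atom rate \<xi> j \<noteq> {}"
  using hedge_exists ask_price_set_of_hedge by blast

lemma ask_price_set_bdd_below: "bdd_below (ask_price_set T atom rate \<xi> j)"
proof -
  fix w :: 'w
  obtain S where S: "S \<in> dual_cone (Q 0 w)" "S $ j = 1"
    using consistent_price_exists[of 0 w j] by auto
  show ?thesis
    using hedge_lower_bound[OF _ S] by (intro bdd_belowI[of _ "S \<bullet> \<xi> 0 w"]) (auto simp: ask_price_set_iff)
qed

section \<open>Weak duality\<close>

lemma expected_tail_nonneg: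
  assumes qS: "(q, S) \<in> Pd T atom rate ch" and t: "t \<le> T"
    and v: "meas atom t v" "\<And>w. v w \<in> Q t w"
  shows "0 \<le> (\<Sum>w\<in>UNIV. q w * (stopped_tail T ch S (Suc t) w \<bullet> v w))"
proof (rule sum_nonneg_of_atoms[OF t])
  fix w
  let ?D = "stopped_tail T ch S (Suc t)"
  let ?m = "\<Sum>u\<in>atom t w. q u"
  have q0: "0 \<le> q u" for u
    using qS by (simp add: Pd_def prob_fun_def)
  have "(\<Sum>u\<in>atom t w. q u * (?D u \<bullet> v u)) = (\<Sum>u\<in>atom t w. q u * (?D u \<bullet> v w))"
    using v(1) by (intro sum.cong) (auto simp: meas_def)
  also have "\<dots> = (\<Sum>u\<in>atom t w. q u *\<^sub>R ?D u) \<bullet> v w"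
    by (simp add: inner_sum_left)
  also have "\<dots> = ?m * (cond_exp q atom t ?D w \<bullet> v w)"
  \<comment> \<open>Where \<open>cond_exp\<close> takes its default 0, \<open>q\<close> vanishes on
    the whole atom, and both sides are 0.\<close>
  proof (cases "?m = 0")
    case True
    then have "q u = 0" if "u \<in> atom t w" for u
      using that q0 by (simp add: sum_nonneg_eq_0_iff)
    then show ?thesis using True by simp
  qed (simp add: cond_exp_def Let_def)
  also have "\<dots> \<ge> 0"
  proof -
    have "cond_exp q atom t ?D w \<in> dual_cone (Q t w)"
      using qS t by (simp add: Pd_def)
    then show ?thesis
      using v(2) q0 by (intro mult_nonneg_nonneg sum_nonneg) (auto simp: dual_cone_def)
  qed
  finally show "0 \<le> (\<Sum>u\<in>atom t w. q u * (?D u \<bullet> v u))" .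
qed

text \<open>Replacing \<open>y t\<close> by \<open>y (Suc t)\<close> against the tail after
  \<open>t\<close> can only lower the expectation, as the conditional tail is dual to the solvent
  increment. The telescope starts at \<open>x\<close>, because the full tail has \<open>j\<close>-th
  component 1, and ends with the stopped value of \<open>S \<bullet> y\<close>, which dominates the
  payoff.\<close>

lemma weak_duality:
  assumes "hedge x y" and ch: "mixed_stopping T atom ch" and qS: "(q, S) \<in> Pd_j T atom rate ch j"
  shows "exp_payoff T q ch \<xi> S \<le> x"
proof -
  have y0: "y 0 w = x *\<^sub>R axis j 1" for w
    using assms(1) by (simp add: hedge_def)
  have ym: "\<forall>t\<in>{1..T}. meas atom (t - 1) (y t)"
    using assms(1) by (simp add: hedge_def)
  have yK: "y t w - y (Suc t) w \<in> K t w" if "t < T" for t w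
    using assms(1) that by (simp add: hedge_def)
  have yQ: "y t w - \<xi> t w \<in> Q t w" if "t \<le> T" for t w
    using assms(1) that Qset_imp_Qcone[of "\<lambda>w. y t w - \<xi> t w" t w] by (auto simp: hedge_def)
  have Pd: "(q, S) \<in> Pd T atom rate ch" and Sj: "\<And>t w. t \<le> T \<Longrightarrow> S t w $ j = 1"
    using qS by (auto simp: Pd_j_def)
  have q: "\<And>w. 0 \<le> q w" "(\<Sum>w\<in>UNIV. q w) = 1"
    using Pd by (auto simp: Pd_def prob_fun_def)
  let ?D = "stopped_tail T ch S"
  have D_Suc: "?D t w = ch t w *\<^sub>R S t w + ?D (Suc t) w" if "t \<le> T" for t w
    using that by (simp add: stopped_tail_def sum.atLeast_Suc_atMost)
  have telescope: "(\<Sum>w\<in>UNIV. q w * (\<Sum>s<t. ch s w * (S s w \<bullet> y s w))) +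
      (\<Sum>w\<in>UNIV. q w * (?D t w \<bullet> y t w)) \<le> (\<Sum>w\<in>UNIV. q w * (?D 0 w \<bullet> y 0 w))"
    if "t \<le> T" for t
    using that
  proof (induction t)
    case (Suc t)
    let ?d = "\<lambda>w. y t w - y (Suc t) w"
    have "meas atom t ?d"
      using Suc.prems bspec[OF ym, of "Suc t"] predictable_meas[OF y0 ym, of t]
      by (intro meas_diff) simp_all
    moreover have "?d w \<in> Q t w" for w
      using Suc.prems yK[of t w] Kcone_subset_Qcone[of t w] by auto
    ultimately have "0 \<le> (\<Sum>w\<in>UNIV. q w * (?D (Suc t) w \<bullet> ?d w))"
      using Suc.prems by (intro expected_tail_nonneg[OF Pd]) auto
    moreover have "q w * (\<Sum>s<Suc t. ch s w * (S s w \<bullet> y s w)) + q w * (?D (Suc t) w \<bullet> y (Suc t) w) =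
       q w * (\<Sum>s<t. ch s w * (S s w \<bullet> y s w)) + q w * (?D t w \<bullet> y t w) - q w * (?D (Suc t) w \<bullet> ?d w)" for w
      using Suc.prems D_Suc[of t w] by (simp add: inner_simps algebra_simps)
    ultimately show ?case
      using Suc.IH Suc.prems by (simp add: sum_subtractf flip: sum.distrib)
  qed simp
  have D0: "?D 0 w \<bullet> y 0 w = x" for w
  proof -
    have "?D 0 w $ j = (\<Sum>t\<le>T. ch t w)"
      by (simp add: stopped_tail_def atLeast0AtMost Sj)
    then show ?thesis
      using mixed_stopping_sum[OF ch] by (simp add: y0 inner_axis)
  qed
  have "exp_payoff T q ch \<xi> S \<le> (\<Sum>w\<in>UNIV. q w * (\<Sum>t\<le>T. ch t w * (S t w \<bullet> y t w)))"
    unfolding exp_payoff_def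
  proof (intro sum_mono mult_left_mono q(1))
    fix w t assume "t \<in> {..T}"
    then have t: "t \<le> T" by simp
    have "S t w \<in> dual_cone (Q t w)"
      using Pd t by (auto simp: Pd_def)
    then have "0 \<le> S t w \<bullet> (y t w - \<xi> t w)"
      using yQ[OF t] by (simp add: dual_cone_def)
    then show "\<xi> t w \<bullet> S t w \<le> S t w \<bullet> y t w"
      by (simp add: inner_diff_right inner_commute)
    show "0 \<le> ch t w"
      by (rule mixed_stopping_nonneg[OF ch t])
  qed
  also have "\<dots> = (\<Sum>w\<in>UNIV. q w * (\<Sum>s<T. ch s w * (S s w \<bullet> y s w))) +
      (\<Sum>w\<in>UNIV. q w * (?D T w \<bullet> y T w))"
    by (simp add: lessThan_Suc_atMost[symmetric] stopped_tail_def distrib_left sum.distrib)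
  also have "\<dots> \<le> (\<Sum>w\<in>UNIV. q w * (?D 0 w \<bullet> y 0 w))"
    by (rule telescope) simp
  also have "\<dots> = x"
    using q(2) by (simp add: D0 flip: sum_distrib_right)
  finally show ?thesis .
qed

section \<open>Lagrange multipliers\<close>

text \<open>The linear constraints of the homogenised pricing problem, where \<open>r\<close> scales the payoff and
  \<open>u t\<close> is the deferral used after exercise at \<open>t\<close>.  The solvency constraints are that all increments
  \<open>y s - y (Suc s)\<close> and \<open>u t s - u t (Suc s)\<close> with \<open>s \<le> T\<close> lie in \<open>K s\<close>.  Putting \<open>u t s = u t t\<close> for
  \<open>s < t\<close> makes the superfluous increments vanish, and the value of \<open>y (Suc T)\<close> encodes \<open>0 \<le> r\<close>.\<close>
definition homogenised :: "real \<Rightarrow> real \<Rightarrow> (nat \<Rightarrow> 'w \<Rightarrow> real^'d) \<Rightarrow> (nat \<Rightarrow> nat \<Rightarrow> 'w \<Rightarrow> real^'d) \<Rightarrow> bool" where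
  "homogenised r x y u \<longleftrightarrow>
     (\<forall>w. y 0 w = x *\<^sub>R axis j 1) \<and> (\<forall>t\<in>{1..T}. meas atom (t - 1) (y t)) \<and>
     (\<forall>w. y (Suc T) w = y T w - r *\<^sub>R axis j 1) \<and>
     (\<forall>t\<le>T. (\<forall>s\<le>t. \<forall>w. u t s w = y t w - r *\<^sub>R \<xi> t w) \<and>
       (\<forall>s\<in>{Suc t..T}. meas atom (s - 1) (u t s)) \<and> (\<forall>w. u t (Suc T) w = 0))"

lemma homogenised_lincomb:
  assumes "homogenised r x y u" "homogenised r' x' y' u'"
  shows "homogenised (r + c * r') (x + c * x') (\<lambda>s w. y s w + c *\<^sub>R y' s w)
    (\<lambda>t s w. u t s w + c *\<^sub>R u' t s w)"
proof -
  have m: "meas atom t f \<Longrightarrow> meas atom t g \<Longrightarrow> meas atom t (\<lambda>w. f w + c *\<^sub>R g w)"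
    for t and f g :: "'w \<Rightarrow> real^'d"
    by (simp add: meas_def)
  show ?thesis
    using assms unfolding homogenised_def 
    by (auto intro!: m simp: scaleR_add_left scaleR_add_right scaleR_diff_right)
qed

lemma ask_price_le_hedge: "hedge x y \<Longrightarrow> ask_price T atom rate \<xi> j \<le> x"
  unfolding ask_price_def
  by (rule cInf_lower[OF ask_price_set_of_hedge ask_price_set_bdd_below])

text \<open>The increment at \<open>T\<close> is \<open>r\<close> units of asset \<open>j\<close>,
  whence \<open>0 \<le> r\<close>. For \<open>r > 0\<close>, division by \<open>r\<close> gives a
  hedge from \<open>x / r\<close>; for \<open>r = 0\<close>, \<open>x\<close> units of asset
  \<open>j\<close> lie in \<open>Q 0 w\<close>, and a normalised price shows
  \<open>0 \<le> x\<close>.\<close>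

lemma homogenised_solvent_bound:
  assumes hom: "homogenised r x y u"
    and yK: "\<And>s w. s \<le> T \<Longrightarrow> y s w - y (Suc s) w \<in> K s w"
    and uK: "\<And>t s w. t \<le> T \<Longrightarrow> s \<le> T \<Longrightarrow> u t s w - u t (Suc s) w \<in> K s w"
  shows "ask_price T atom rate \<xi> j * r \<le> x"
proof -
  have y0: "y 0 w = x *\<^sub>R axis j 1" for w
    using hom by (simp add: homogenised_def)
  have ym: "\<forall>t\<in>{1..T}. meas atom (t - 1) (y t)"
    using hom by (simp add: homogenised_def)
  have u_eq: "u t t w = y t w - r *\<^sub>R \<xi> t w" if "t \<le> T" for t w
    using hom that by (simp add: homogenised_def)
  have um: "meas atom (s - 1) (u t s)" if "t \<le> T" "s \<in> {Suc t..T}" for t s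
    using hom that by (simp add: homogenised_def)
  have uT: "u t (Suc T) = (\<lambda>_. 0)" if "t \<le> T" for t
    using hom that by (simp add: homogenised_def fun_eq_iff)
  have u_def: "deferral t (u t)" if "t \<le> T" for t
  proof -
    have "meas atom t (u t t)"
      using predictable_meas[OF y0 ym that] payoff_meas[OF that] u_eq[OF that] by (simp add: meas_def)
    then show ?thesis
      unfolding deferral_def using um[OF that] uT[OF that] uK[OF that] by (auto simp: le_Suc_eq)
  qed
  have r: "0 \<le> r"
  proof -
    fix w :: 'w
    obtain S where S: "S \<in> dual_cone (Q T w)" "S $ j = 1"
      using consistent_price_exists[of T w j] by auto
    have "r *\<^sub>R axis j 1 \<in> K T w"
      using yK[of T w] hom by (simp add: homogenised_def)
    from dual_Qcone_nonneg[OF _ S(1) this] show ?thesis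
      using S(2) by (simp add: inner_axis)
  qed
  show ?thesis
  proof (cases "r = 0")
    case True
    fix w :: 'w
    obtain S where S: "S \<in> dual_cone (Q 0 w)" "S $ j = 1"
      using consistent_price_exists[of 0 w j] by auto
    have "u 0 0 \<in> Qset T atom rate 0"
      using u_def[of 0] by (auto simp: Qset_iff_deferral)
    then have "x *\<^sub>R axis j 1 \<in> Q 0 w"
      using Qset_imp_Qcone[of "u 0 0" 0 w] u_eq[of 0 w] y0 True by simp
    then have "0 \<le> S \<bullet> (x *\<^sub>R axis j 1)"
      using S(1) unfolding dual_cone_def by blast
    then show ?thesis
      using S(2) True by (simp add: inner_axis)
  next
    case False
    with r have pos: "0 < 1 / r" by simp
    let ?y = "\<lambda>s w. (1 / r) *\<^sub>R y s w"
    have "(\<lambda>w. ?y t w - \<xi> t w) \<in> Qset T atom rate t" if "t \<le> T" for t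
    proof -
      have "deferral t (\<lambda>s w. (1 / r) *\<^sub>R u t s w)"
        using u_def[OF that] pos by (intro deferral_scaleR) simp_all
      moreover have "(\<lambda>w. (1 / r) *\<^sub>R u t t w) = (\<lambda>w. ?y t w - \<xi> t w)"
        using False u_eq[OF that] by (simp add: scaleR_diff_right)
      ultimately show ?thesis
        unfolding Qset_iff_deferral[OF that] by blast
    qed
    moreover have "?y t w - ?y (Suc t) w \<in> K t w" if "t < T" for t w
      using Kcone_scaleR[OF yK[of t w], of "1 / r"] pos that by (simp add: scaleR_diff_right)
    ultimately have "hedge (x / r) ?y"
      unfolding hedge_def using y0 ym by (auto simp: meas_def)
    from ask_price_le_hedge[OF this] show ?thesis
      using pos by (simp add: field_simps)
  qed
qed

text \<open>\<open>conic_farkas\<close> turns the implication of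
  \<open>homogenised_solvent_bound\<close> into an identity. It holds for all homogenised tuples,
  solvent or not, and so can be tested with any of them.\<close>

lemma lagrange_multipliers:
  obtains A C where
    "\<And>s w. s \<le> T \<Longrightarrow> A s w \<in> dual_cone (K s w)"
    "\<And>t s w. t \<le> T \<Longrightarrow> s \<le> T \<Longrightarrow> C t s w \<in> dual_cone (K s w)"
    "\<And>r x y u. homogenised r x y u \<Longrightarrow> x - ask_price T atom rate \<xi> j * r =
      (\<Sum>s\<le>T. \<Sum>w\<in>UNIV. A s w \<bullet> (y s w - y (Suc s) w)) +
      (\<Sum>t\<le>T. \<Sum>s\<le>T. \<Sum>w\<in>UNIV. C t s w \<bullet> (u t s w - u t (Suc s) w))"
proof -
  let ?p = "ask_price T atom rate \<xi> j"
  define D where "D = {(r, x, y, u). homogenised r x y u}"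
  define g where "g = (\<lambda>(r, x, y :: nat \<Rightarrow> 'w \<Rightarrow> real^'d, u :: nat \<Rightarrow> nat \<Rightarrow> 'w \<Rightarrow> real^'d). x - ?p * r)"
  \<comment> \<open>The first index is 0 for the increments of \<open>y\<close> and
    \<open>Suc t\<close> for those of \<open>u t\<close>.\<close>
  define F where "F = (\<lambda>(n, s, w) (r :: real, x :: real, y :: nat \<Rightarrow> 'w \<Rightarrow> real^'d, u).
    case n of 0 \<Rightarrow> y s w - y (Suc s) w | Suc t \<Rightarrow> u t s w - u t (Suc s) w)"
  define I where "I = {..Suc T} \<times> {..T} \<times> (UNIV :: 'w set)"
  define G :: "nat \<times> nat \<times> 'w \<Rightarrow> (real^'d) set"
    where "G = (\<lambda>(n, s, w). {axis i 1 | i. True} \<union> {rate s w j k *\<^sub>R axis j 1 - axis k 1 | j k. True})"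
  have hull_G: "convex_cone hull G (n, s, w) = K s w" for n s w
    by (simp add: G_def Kcone_def)
  have "\<exists>a. (\<forall>i\<in>I. \<forall>v\<in>convex_cone hull G i. 0 \<le> a i \<bullet> v) \<and>
      (\<forall>z\<in>D. g z = (\<Sum>i\<in>I. a i \<bullet> F i z))"
  proof (rule conic_farkas)
    show "finite I" by (simp add: I_def)
    show "finite (G i)" if "i \<in> I" for i
      unfolding G_def using finite_Kcone_generators by (simp add: split_beta)
  next
    fix z z' c assume "z \<in> D" "z' \<in> D"
    then obtain r x y u r' x' y' u' where z: "z = (r, x, y, u)" "homogenised r x y u"
        "z' = (r', x', y', u')" "homogenised r' x' y' u'"
      by (auto simp: D_def)
    let ?z = "(r + c * r', x + c * x', \<lambda>s w. y s w + c *\<^sub>R y' s w, \<lambda>t s w. u t s w + c *\<^sub>R u' t s w)"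
    have "?z \<in> D"
      using homogenised_lincomb[OF z(2,4)] by (simp add: D_def)
    moreover have "g ?z = g z + c * g z'"
      by (simp add: g_def z algebra_simps)
    moreover have "F i ?z = F i z + c *\<^sub>R F i z'" for i
      by (auto simp: F_def z algebra_simps split: nat.split prod.split)
    ultimately show "\<exists>v\<in>D. g v = g z + c * g z' \<and> (\<forall>i\<in>I. F i v = F i z + c *\<^sub>R F i z')"
      by blast
  next
    fix z assume "z \<in> D" and K: "\<forall>i\<in>I. F i z \<in> convex_cone hull G i"
    then obtain r x y u where z: "z = (r, x, y, u)" "homogenised r x y u"
      by (auto simp: D_def)
    have "y s w - y (Suc s) w \<in> K s w" if "s \<le> T" for s w
      using bspec[OF K, of "(0, s, w)"] that by (simp add: I_def F_def z hull_G)
    moreover have "u t s w - u t (Suc s) w \<in> K s w" if "t \<le> T" "s \<le> T" for t s w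
      using bspec[OF K, of "(Suc t, s, w)"] that by (simp add: I_def F_def z hull_G)
    ultimately show "0 \<le> g z"
      using homogenised_solvent_bound[OF z(2)] by (simp add: g_def z(1))
  qed
  then obtain a where a: "\<forall>i\<in>I. \<forall>v\<in>convex_cone hull G i. 0 \<le> a i \<bullet> v"
    and eq: "\<forall>z\<in>D. g z = (\<Sum>i\<in>I. a i \<bullet> F i z)" by blast
  have dual: "a (n, s, w) \<in> dual_cone (K s w)" if "n \<le> Suc T" "s \<le> T" for n s w
    using bspec[OF a, of "(n, s, w)"] that by (simp add: I_def hull_G dual_cone_def)
  show thesis
  proof (rule that[of "\<lambda>s w. a (0, s, w)" "\<lambda>t s w. a (Suc t, s, w)"])
    fix r x y u assume "homogenised r x y u"
    then have "x - ?p * r = (\<Sum>i\<in>I. a i \<bullet> F i (r, x, y, u))"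
      using bspec[OF eq, of "(r, x, y, u)"] by (simp add: D_def g_def)
    also have "\<dots> = (\<Sum>n\<le>Suc T. \<Sum>s\<le>T. \<Sum>w\<in>UNIV. a (n, s, w) \<bullet> F (n, s, w) (r, x, y, u))"
      by (simp add: I_def sum.cartesian_product split_beta)
    also have "\<dots> = (\<Sum>s\<le>T. \<Sum>w\<in>UNIV. a (0, s, w) \<bullet> (y s w - y (Suc s) w)) +
      (\<Sum>t\<le>T. \<Sum>s\<le>T. \<Sum>w\<in>UNIV. a (Suc t, s, w) \<bullet> (u t s w - u t (Suc s) w))"
      unfolding sum.atMost_Suc_shift by (simp add: F_def)
    finally show "x - ?p * r = \<dots>" .
  qed (use dual in auto)
qed

lemma sum_restrict_atom: "(\<Sum>v\<in>UNIV. f v \<bullet> restrict_atom t w g v) = (\<Sum>v\<in>atom t w. f v \<bullet> g v)"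
  for f g :: "'w \<Rightarrow> real^'d"
  by (simp add: if_distrib sum.If_cases cong: if_cong)

text \<open>The path \<open>x\<close> jumps from \<open>0\<close> onto the deferral \<open>z\<close> at time \<open>t\<close>, so its increments are solvent except for
  \<open>- z (Suc t)\<close>, which falls short of the solvent increment of \<open>z\<close> by \<open>z t\<close>.  With \<open>b\<close> the final
  liquidation is dropped.\<close>
lemma deferral_increments:
  assumes L: "\<And>s w. s \<le> T \<Longrightarrow> L s w \<in> dual_cone (K s w)"
    and z: "deferral t z" and t: "t \<le> T"
    and x: "\<And>s. s \<le> t \<Longrightarrow> x s = (\<lambda>_. 0)"
      "\<And>s. s \<in> {t<..T} \<Longrightarrow> x s = restrict_atom t w (z s)"
      "x (Suc T) = (if b then x T else (\<lambda>_. 0))" and "t < T \<or> \<not> b"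
  shows "(\<Sum>s\<le>T. \<Sum>v\<in>UNIV. L s v \<bullet> (x s v - x (Suc s) v)) +
    (\<Sum>v\<in>atom t w. L t v) \<bullet> z t w \<ge> 0"
proof -
  let ?z = "\<lambda>s. restrict_atom t w (z s)"
  define e where "e s v = (if s = t then L t v \<bullet> ?z t v else 0)" for s v
  have zT: "z (Suc T) = (\<lambda>_. 0)"
    using z by (simp add: deferral_def)
  have inc: "0 \<le> L s v \<bullet> (?z s v - ?z (Suc s) v)" if "t \<le> s" "s \<le> T" for s v
  proof -
    have "z s v - z (Suc s) v \<in> K s v"
      using z that by (simp add: deferral_def)
    then show ?thesis
      using L[OF that(2), of v] by (auto simp: dual_cone_def)
  qed
  have "0 \<le> L s v \<bullet> (x s v - x (Suc s) v) + e s v" if s: "s \<le> T" for s v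
  proof -
    consider "s < t" | "s = t" | "t < s" "s < T" | "t < s" "s = T"
      using s by linarith
    then show ?thesis
    proof cases
      case 1
      then show ?thesis by (simp add: x(1) e_def)
    next
      case 2
      have "x (Suc t) = ?z (Suc t)"
        using x(2)[of "Suc t"] x(3) t zT assms(7) by (cases "t = T") (auto simp: fun_eq_iff)
      then show ?thesis
        using 2 inc[of s v] t
        by (cases "v \<in> atom t w") (simp_all add: x(1) e_def inner_diff_right)
    next
      case 3
      then show ?thesis
        using inc[of s v] x(2)[of s] x(2)[of "Suc s"] by (simp add: e_def)
    next
      case 4
      then show ?thesis
        using inc[of s v] x(2)[of s] x(3) zT
        by (cases b; cases "v \<in> atom t w") (simp_all add: e_def)
    qed
  qed
  then have "0 \<le> (\<Sum>s\<le>T. \<Sum>v\<in>UNIV. L s v \<bullet> (x s v - x (Suc s) v) + e s v)"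
    by (intro sum_nonneg) auto
  also have "\<dots> = (\<Sum>s\<le>T. \<Sum>v\<in>UNIV. L s v \<bullet> (x s v - x (Suc s) v)) + (\<Sum>s\<le>T. \<Sum>v\<in>UNIV. e s v)"
    by (simp add: sum.distrib)
  also have "(\<Sum>s\<le>T. \<Sum>v\<in>UNIV. e s v) = (\<Sum>s\<le>T. if s = t then (\<Sum>v\<in>atom t w. L t v \<bullet> z t v) else 0)"
    by (intro sum.cong) (auto simp: e_def sum_restrict_atom)
  also have "\<dots> = (\<Sum>v\<in>atom t w. L t v \<bullet> z t v)"
    using t by simp
  also have "\<dots> = (\<Sum>v\<in>atom t w. L t v \<bullet> z t w)"
    using z by (intro sum.cong) (auto simp: deferral_def meas_def)
  finally show ?thesis
    by (simp add: inner_sum_left)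
qed

text \<open>Each property comes from one test tuple in the multiplier identity. The multipliers
  \<open>A\<close> are eliminated because their atom sums turn out to be tail sums of
  \<open>B\<close>.\<close>

lemma dual_optimiser:
  obtains B where
    "\<And>t w. t \<le> T \<Longrightarrow> (\<Sum>v\<in>atom t w. B t v) \<in> dual_cone (Q t w)"
    "\<And>t w. t \<le> T \<Longrightarrow> (\<Sum>v\<in>atom t w. \<Sum>s\<in>{Suc t..T}. B s v) \<in> dual_cone (Q t w)"
    "(\<Sum>t\<le>T. \<Sum>w\<in>UNIV. B t w $ j) = 1"
    "ask_price T atom rate \<xi> j \<le> (\<Sum>t\<le>T. \<Sum>w\<in>UNIV. B t w \<bullet> \<xi> t w)"
proof -
  let ?p = "ask_price T atom rate \<xi> j"
  obtain A C where A: "\<And>s w. s \<le> T \<Longrightarrow> A s w \<in> dual_cone (K s w)"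
    and C: "\<And>t s w. t \<le> T \<Longrightarrow> s \<le> T \<Longrightarrow> C t s w \<in> dual_cone (K s w)"
    and eq: "\<And>r x y u. homogenised r x y u \<Longrightarrow> x - ?p * r =
      (\<Sum>s\<le>T. \<Sum>w\<in>UNIV. A s w \<bullet> (y s w - y (Suc s) w)) +
      (\<Sum>t\<le>T. \<Sum>s\<le>T. \<Sum>w\<in>UNIV. C t s w \<bullet> (u t s w - u t (Suc s) w))"
    by (rule lagrange_multipliers) blast
  define B where "B t w = C t t w" for t w
  have eq_liquidate: "x - ?p * r = (\<Sum>s\<le>T. \<Sum>w\<in>UNIV. A s w \<bullet> (y s w - y (Suc s) w)) +
      (\<Sum>t\<le>T. \<Sum>w\<in>UNIV. B t w \<bullet> (y t w - r *\<^sub>R \<xi> t w))"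
    if "\<And>w. y 0 w = x *\<^sub>R axis j 1" "\<And>t. t \<in> {1..T} \<Longrightarrow> meas atom (t - 1) (y t)"
      "\<And>w. y (Suc T) w = y T w - r *\<^sub>R axis j 1" for r x y
  proof -
    \<comment> \<open>Everything is dropped right after exercise, so \<open>u t\<close> has its only
      increment at \<open>s = t\<close>, with multiplier \<open>B t\<close>.\<close>
    let ?u = "\<lambda>t s w. if s \<le> t then y t w - r *\<^sub>R \<xi> t w else 0"
    have "homogenised r x y ?u"
      using that by (simp add: homogenised_def)
    moreover have "(\<Sum>s\<le>T. \<Sum>w\<in>UNIV. C t s w \<bullet> (?u t s w - ?u t (Suc s) w)) =
        (\<Sum>w\<in>UNIV. B t w \<bullet> (y t w - r *\<^sub>R \<xi> t w))" if "t \<le> T" for t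
    proof -
      have "(\<Sum>s\<le>T. \<Sum>w\<in>UNIV. C t s w \<bullet> (?u t s w - ?u t (Suc s) w)) =
          (\<Sum>s\<le>T. if s = t then \<Sum>w\<in>UNIV. B t w \<bullet> (y t w - r *\<^sub>R \<xi> t w) else 0)"
      proof (rule sum.cong)
        fix s
        consider "s < t" | "s = t" | "t < s" by linarith
        then show "(\<Sum>w\<in>UNIV. C t s w \<bullet> (?u t s w - ?u t (Suc s) w)) =
            (if s = t then \<Sum>w\<in>UNIV. B t w \<bullet> (y t w - r *\<^sub>R \<xi> t w) else 0)"
          by cases (auto simp: B_def)
      qed simp
      then show ?thesis using that by simp
    qed
    ultimately show ?thesis
      using eq by simp
  qed
  have B_dual: "(\<Sum>v\<in>atom t w. B t v) \<in> dual_cone (Q t w)" if t: "t \<le> T" for t w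
    unfolding dual_cone_def
  proof (intro CollectI ballI)
    fix v assume "v \<in> Q t w"
    then obtain z where z: "deferral t z" "z t w = v"
      using Qset_iff_deferral[OF t] by (auto simp: Qcone_def)
    \<comment> \<open>With \<open>r\<close>, \<open>x\<close> and \<open>y\<close> zero the identity
      equates the multiplier sum to 0, so the shortfall in \<open>deferral_increments\<close> is
      nonnegative.\<close>
    let ?u = "\<lambda>t' s. if t' = t \<and> s \<in> {t<..T} then restrict_atom t w (z s) else (\<lambda>_. 0)"
    have hom: "homogenised 0 0 (\<lambda>_ _. 0) ?u"
      using z(1) by (auto simp: homogenised_def deferral_def intro!: meas_restrict_atom)
    have "(\<Sum>s\<le>T. \<Sum>w\<in>UNIV. C t s w \<bullet> (?u t s w - ?u t (Suc s) w)) =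
        (\<Sum>t'\<le>T. \<Sum>s\<le>T. \<Sum>w\<in>UNIV. C t' s w \<bullet> (?u t' s w - ?u t' (Suc s) w))"
      by (subst sum.mono_neutral_right[of "{..T}" "{t}"]) (use t in auto)
    also have "\<dots> = 0"
      using eq[OF hom] by simp
    finally have "(\<Sum>s\<le>T. \<Sum>w\<in>UNIV. C t s w \<bullet> (?u t s w - ?u t (Suc s) w)) = 0" .
    moreover have "0 \<le> (\<Sum>s\<le>T. \<Sum>v\<in>UNIV. C t s v \<bullet> (?u t s v - ?u t (Suc s) v)) +
        (\<Sum>v\<in>atom t w. C t t v) \<bullet> z t w"
      by (rule deferral_increments[where b = False]) (use C z t in auto)
    ultimately show "0 \<le> (\<Sum>v\<in>atom t w. B t v) \<bullet> v"
      by (simp add: B_def z(2))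
  qed
  have A_dual: "0 \<le> (\<Sum>v\<in>atom t w. A t v) \<bullet> x" if t: "t < T" and x: "x \<in> Q t w" for t w x
  proof -
    obtain z where z: "deferral t z" "z t w = x"
      using x t Qset_iff_deferral[of t] by (auto simp: Qcone_def)
    have zT: "z (Suc T) = (\<lambda>_. 0)"
      using z by (simp add: deferral_def)
    \<comment> \<open>The cap \<open>min s T\<close> is there because \<open>r = 0\<close> forces
      \<open>y (Suc T) = y T\<close>. After exercise at \<open>t' > t\<close> the path
      \<open>u t'\<close> goes on along \<open>z\<close>, so the \<open>C\<close> part is
      nonnegative and the \<open>A\<close> part nonpositive.\<close>
    let ?y = "\<lambda>s. if s \<le> t then (\<lambda>_. 0) else restrict_atom t w (z (min s T))"
    let ?u = "\<lambda>t' s. if t' \<le> t then (\<lambda>_. 0) else restrict_atom t w (z (max t' s))"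
    have "homogenised 0 0 ?y ?u"
      using z(1) t zT by (auto simp: homogenised_def deferral_def intro!: meas_restrict_atom)
    from eq[OF this] have "(\<Sum>s\<le>T. \<Sum>w\<in>UNIV. A s w \<bullet> (?y s w - ?y (Suc s) w)) +
      (\<Sum>t\<le>T. \<Sum>s\<le>T. \<Sum>w\<in>UNIV. C t s w \<bullet> (?u t s w - ?u t (Suc s) w)) = 0" by simp
    moreover have "0 \<le> (\<Sum>t\<le>T. \<Sum>s\<le>T. \<Sum>w\<in>UNIV. C t s w \<bullet> (?u t s w - ?u t (Suc s) w))"
    proof (intro sum_nonneg)
      fix t' s v assume "t' \<in> {..T}" "s \<in> {..T}"
      then have "?u t' s v - ?u t' (Suc s) v \<in> K s v"
        using z(1) by (auto simp: deferral_def max_def not_le less_Suc_eq_le le_Suc_eq)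
      then show "0 \<le> C t' s v \<bullet> (?u t' s v - ?u t' (Suc s) v)"
        using C[of t' s v] \<open>t' \<in> {..T}\<close> \<open>s \<in> {..T}\<close> by (simp add: dual_cone_def)
    qed
    moreover have "0 \<le> (\<Sum>s\<le>T. \<Sum>v\<in>UNIV. A s v \<bullet> (?y s v - ?y (Suc s) v)) +
        (\<Sum>v\<in>atom t w. A t v) \<bullet> z t w"
      by (rule deferral_increments[where b = True]) (use A z t in auto)
    ultimately show ?thesis
      by (simp add: z(2))
  qed
  have tail_eq: "(\<Sum>v\<in>atom t w. \<Sum>s\<in>{Suc t..T}. B s v) \<bullet> x = (\<Sum>v\<in>atom t w. A t v) \<bullet> x"
    if t: "t < T" for t w x
  proof -
    \<comment> \<open>Acquire an arbitrary \<open>x\<close> on the atom right after \<open>t\<close>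
      and hold it until exercise: \<open>A\<close> sees only the jump, \<open>B\<close> the position
      at all later times.\<close>
    let ?y = "\<lambda>s. if s \<le> t then (\<lambda>_. 0) else restrict_atom t w (\<lambda>_. x)"
    have "meas atom (s - 1) (?y s)" if "s \<in> {1..T}" for s
      using that by (auto intro!: meas_restrict_atom)
    then have "0 = (\<Sum>s\<le>T. \<Sum>w\<in>UNIV. A s w \<bullet> (?y s w - ?y (Suc s) w)) +
        (\<Sum>s\<le>T. \<Sum>w\<in>UNIV. B s w \<bullet> ?y s w)"
      using eq_liquidate[of ?y 0 0] t by simp
    moreover have "(\<Sum>s\<le>T. \<Sum>v\<in>UNIV. A s v \<bullet> (?y s v - ?y (Suc s) v)) =
        (\<Sum>s\<le>T. if s = t then - (\<Sum>v\<in>atom t w. A t v) \<bullet> x else 0)"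
    proof (rule sum.cong)
      fix s
      show "(\<Sum>v\<in>UNIV. A s v \<bullet> (?y s v - ?y (Suc s) v)) =
          (if s = t then - (\<Sum>v\<in>atom t w. A t v) \<bullet> x else 0)"
        using sum_restrict_atom[of "A t" t w "\<lambda>_. x"]
        by (cases "s = t") (auto simp: inner_sum_left sum_negf le_Suc_eq)
    qed simp
    moreover have "(\<Sum>s\<le>T. \<Sum>v\<in>UNIV. B s v \<bullet> ?y s v) =
        (\<Sum>s\<in>{Suc t..T}. \<Sum>v\<in>atom t w. B s v \<bullet> x)"
    proof -
      have "(\<Sum>s\<le>T. \<Sum>v\<in>UNIV. B s v \<bullet> ?y s v) = (\<Sum>s\<in>{Suc t..T}. \<Sum>v\<in>UNIV. B s v \<bullet> ?y s v)"
        by (rule sum.mono_neutral_right) auto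
      then show ?thesis
        by (simp add: sum_restrict_atom)
    qed
    ultimately have "(\<Sum>s\<in>{Suc t..T}. \<Sum>v\<in>atom t w. B s v \<bullet> x) = (\<Sum>v\<in>atom t w. A t v) \<bullet> x"
      using t by simp
    then show ?thesis
      by (subst sum.swap) (simp add: inner_sum_left)
  qed
  \<comment> \<open>Test with one unit of asset \<open>j\<close> held throughout and
    \<open>r = 0\<close>; \<open>y\<close> has no increments.\<close>
  have total: "(\<Sum>t\<le>T. \<Sum>w\<in>UNIV. B t w $ j) = 1"
    using eq_liquidate[of "\<lambda>_ _. axis j 1" 1 0] by (simp add: inner_axis)
  have "0 \<le> (\<Sum>w\<in>UNIV. A T w \<bullet> axis j 1)"
    using A[of T] by (intro sum_nonneg) (simp add: dual_cone_def)
  moreover have "- ?p = (\<Sum>w\<in>UNIV. A T w \<bullet> axis j 1) - (\<Sum>t\<le>T. \<Sum>w\<in>UNIV. B t w \<bullet> \<xi> t w)"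
  proof -
    \<comment> \<open>For \<open>r = 1\<close> and zero positions up to \<open>T\<close>, the
      constraint fixes this final value. Its multiplier is the slack in the inequality for
      \<open>?p\<close>.\<close>
    let ?y = "\<lambda>s w. if s = Suc T then - axis j 1 else 0 :: real^'d"
    have "(\<Sum>s\<le>T. \<Sum>w\<in>UNIV. A s w \<bullet> (?y s w - ?y (Suc s) w)) =
        (\<Sum>s\<le>T. if s = T then \<Sum>w\<in>UNIV. A T w \<bullet> axis j 1 else 0)"
      by (intro sum.cong) auto
    moreover have "(\<Sum>t\<le>T. \<Sum>w\<in>UNIV. B t w \<bullet> (?y t w - 1 *\<^sub>R \<xi> t w)) = - (\<Sum>t\<le>T. \<Sum>w\<in>UNIV. B t w \<bullet> \<xi> t w)"
      unfolding sum_negf[symmetric] by (intro sum.cong) auto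
    ultimately show ?thesis
      using eq_liquidate[of ?y 0 1] by simp
  qed
  ultimately have "?p \<le> (\<Sum>t\<le>T. \<Sum>w\<in>UNIV. B t w \<bullet> \<xi> t w)"
    by simp
  moreover have "(\<Sum>v\<in>atom t w. \<Sum>s\<in>{Suc t..T}. B s v) \<in> dual_cone (Q t w)" if "t \<le> T" for t w
    using A_dual[of t _ w] tail_eq[of t w] that by (cases "t = T") (auto simp: dual_cone_def)
  ultimately show thesis
    using that B_dual total by blast
qed

section \<open>Attainment of the maximum\<close>

lemma strong_duality:
  "\<exists>ch q S. mixed_stopping T atom ch \<and> (q, S) \<in> Pd_j T atom rate ch j \<and>
    ask_price T atom rate \<xi> j \<le> exp_payoff T q ch \<xi> S"
proof -
  obtain B where B: "\<And>t w. t \<le> T \<Longrightarrow> (\<Sum>v\<in>atom t w. B t v) \<in> dual_cone (Q t w)"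
    and B_tail: "\<And>t w. t \<le> T \<Longrightarrow> (\<Sum>v\<in>atom t w. \<Sum>s\<in>{Suc t..T}. B s v) \<in> dual_cone (Q t w)"
    and B_total: "(\<Sum>t\<le>T. \<Sum>w\<in>UNIV. B t w $ j) = 1"
    and B_value: "ask_price T atom rate \<xi> j \<le> (\<Sum>t\<le>T. \<Sum>w\<in>UNIV. B t w \<bullet> \<xi> t w)"
    by (rule dual_optimiser) blast
  define R where "R t = atom_average t (B t)" for t
  have R_meas: "meas atom t (R t)" for t
    by (simp add: R_def meas_atom_average)
  have R_sum: "(\<Sum>v\<in>atom t w. R t v) = (\<Sum>v\<in>atom t w. B t v)" for t w
    by (simp add: R_def sum_atom_average)
  have R_dual: "R t w \<in> dual_cone (Q t w)" if "t \<le> T" for t w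
    unfolding R_def atom_average_def using B[OF that] by (intro dual_cone_scaleR) simp_all
  define b where "b t w = R t w $ j" for t w
  have b0: "0 \<le> b t w" if "t \<le> T" for t w
    using dual_Qcone_components(1)[OF that R_dual[OF that]] by (simp add: b_def)
  have "(\<Sum>t\<le>T. \<Sum>w\<in>UNIV. b t w) = (\<Sum>t\<le>T. (\<Sum>w\<in>UNIV. R t w) $ j)"
    by (simp add: b_def)
  also have "\<dots> = (\<Sum>t\<le>T. (\<Sum>w\<in>UNIV. B t w) $ j)"
    using sum_UNIV_eq_of_atoms[OF _ R_sum] by (intro sum.cong) auto
  finally have "(\<Sum>w\<in>UNIV. \<Sum>t\<le>T. b t w) = 1"
    using B_total by (subst sum.swap) simp
  with b0 obtain q ch where q: "prob_fun q" and ch: "mixed_stopping T atom ch"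
    and qch: "\<And>t w. t \<le> T \<Longrightarrow> (\<Sum>v\<in>atom t w. q v * ch t v) = (\<Sum>v\<in>atom t w. b t v)"
    by (rule mixed_stopping_decomposition) blast+
  \<comment> \<open>The choice depends on \<open>w\<close> only through \<open>Q t w\<close>, hence
    is constant on atoms.\<close>
  define s0 where "s0 t w = (SOME S. S \<in> dual_cone (Q t w) \<and> S $ j = 1)" for t w
  have s0: "s0 t w \<in> dual_cone (Q t w) \<and> s0 t w $ j = 1" if "t \<le> T" for t w
    unfolding s0_def by (rule someI_ex) (use consistent_price_exists[OF that, of w j] in blast)
  have s0_meas: "meas atom t (s0 t)" for t
    by (simp add: meas_def s0_def Qcone_atom)
  define S where "S t w = (if b t w = 0 then s0 t w else (1 / b t w) *\<^sub>R R t w)" for t w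
  have S_meas: "meas atom t (S t)" for t
    unfolding meas_def
  proof (intro allI impI)
    fix w v assume "v \<in> atom t w"
    then have "s0 t v = s0 t w" "R t v = R t w"
      using s0_meas[of t] R_meas[of t] unfolding meas_def by blast+
    then show "S t v = S t w" by (simp add: S_def b_def)
  qed
  have S_dual: "S t w \<in> dual_cone (Q t w)" and S_j: "S t w $ j = 1" if "t \<le> T" for t w
    using s0[OF that, of w] dual_cone_scaleR[OF R_dual[OF that, of w], of "1 / b t w"] b0[OF that, of w]
    by (auto simp: S_def b_def)
  have bS: "b t w *\<^sub>R S t w = R t w" if "t \<le> T" for t w
    using dual_Qcone_eq_0[OF that R_dual[OF that], of w j] by (auto simp: S_def b_def)
  \<comment> \<open>By measurability \<open>S\<close> leaves the sum, so only the atom sums of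
    \<open>q v * ch t v\<close> count, and these are prescribed by \<open>b\<close>.\<close>
  have qchS: "(\<Sum>v\<in>atom t w. (q v * ch t v) *\<^sub>R S t v) = (\<Sum>v\<in>atom t w. B t v)" if t: "t \<le> T" for t w
  proof -
    have "(\<Sum>v\<in>atom t w. (q v * ch t v) *\<^sub>R S t v) = (\<Sum>v\<in>atom t w. q v * ch t v) *\<^sub>R S t w"
      unfolding scaleR_sum_left using S_meas[of t] by (intro sum.cong) (auto simp: meas_def)
    also have "\<dots> = (\<Sum>v\<in>atom t w. b t v *\<^sub>R S t v)"
      unfolding qch[OF t] scaleR_sum_left using S_meas[of t] by (intro sum.cong) (auto simp: meas_def)
    also have "\<dots> = (\<Sum>v\<in>atom t w. R t v)"
      by (intro sum.cong bS[OF t]) simp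
    finally show ?thesis
      by (simp add: R_sum)
  qed
  have tail_dual: "cond_exp q atom t (stopped_tail T ch S (t + 1)) w \<in> dual_cone (Q t w)"
    if t: "t \<le> T" for t w
  proof -
    let ?m = "\<Sum>v\<in>atom t w. q v"
    have "(\<Sum>v\<in>atom t w. q v *\<^sub>R stopped_tail T ch S (t + 1) v) =
        (\<Sum>s\<in>{Suc t..T}. \<Sum>v\<in>atom t w. (q v * ch s v) *\<^sub>R S s v)"
      unfolding stopped_tail_def scaleR_sum_right by (subst sum.swap) simp
    also have "\<dots> = (\<Sum>s\<in>{Suc t..T}. \<Sum>v\<in>atom t w. B s v)"
    proof (rule sum.cong)
      fix s assume "s \<in> {Suc t..T}"
      then show "(\<Sum>v\<in>atom t w. (q v * ch s v) *\<^sub>R S s v) = (\<Sum>v\<in>atom t w. B s v)"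
        by (intro sum_atom_refine[of t s]) (auto simp: qchS)
    qed simp
    also have "\<dots> = (\<Sum>v\<in>atom t w. \<Sum>s\<in>{Suc t..T}. B s v)"
      by (rule sum.swap)
    \<comment> \<open>Valid for \<open>?m = 0\<close> too: the default 0 agrees with
      \<open>1 / 0 = 0\<close>.\<close>
    finally have "cond_exp q atom t (stopped_tail T ch S (t + 1)) w =
        (1 / ?m) *\<^sub>R (\<Sum>v\<in>atom t w. \<Sum>s\<in>{Suc t..T}. B s v)"
      by (simp add: cond_exp_def Let_def)
    moreover have "0 \<le> ?m"
      using q by (intro sum_nonneg) (simp add: prob_fun_def)
    ultimately show ?thesis
      using B_tail[OF t, of w] by (simp add: dual_cone_scaleR)
  qed
  have S_ne: "S t w \<noteq> 0" if "t \<le> T" for t w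
    using S_j[OF that, of w] by auto
  have "adapted T atom S"
    using S_meas by (simp add: adapted_def)
  then have "(q, S) \<in> Pd_j T atom rate ch j"
    using q S_dual S_ne S_j tail_dual by (simp add: Pd_j_def Pd_def)
  moreover have "exp_payoff T q ch \<xi> S = (\<Sum>t\<le>T. \<Sum>w\<in>UNIV. B t w \<bullet> \<xi> t w)"
  proof -
    have "exp_payoff T q ch \<xi> S = (\<Sum>t\<le>T. \<Sum>w\<in>UNIV. (q w * ch t w) *\<^sub>R S t w \<bullet> \<xi> t w)"
      unfolding exp_payoff_def sum_distrib_left
      by (subst sum.swap) (simp add: inner_commute mult.assoc)
    also have "\<dots> = (\<Sum>t\<le>T. \<Sum>w\<in>UNIV. B t w \<bullet> \<xi> t w)"
    proof (rule sum.cong)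
      fix t assume "t \<in> {..T}"
      then have t: "t \<le> T" by simp
      have const: "(\<Sum>v\<in>atom t w. f v \<bullet> \<xi> t v) = (\<Sum>v\<in>atom t w. f v) \<bullet> \<xi> t w"
        for f :: "'w \<Rightarrow> real^'d" and w
        unfolding inner_sum_left using payoff_meas[OF t] by (intro sum.cong) (auto simp: meas_def)
      show "(\<Sum>w\<in>UNIV. (q w * ch t w) *\<^sub>R S t w \<bullet> \<xi> t w) = (\<Sum>w\<in>UNIV. B t w \<bullet> \<xi> t w)"
        by (rule sum_UNIV_eq_of_atoms[OF t]) (simp only: const qchS[OF t])
    qed simp
    finally show ?thesis .
  qed
  ultimately show ?thesis
    using ch B_value by fastforce
qed

lemma ask_price_duality:
  "\<exists>chh qh Sh. mixed_stopping T atom chh \<and> (qh, Sh) \<in> Pd_j T atom rate chh j \<and>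
    ask_price T atom rate \<xi> j = exp_payoff T qh chh \<xi> Sh \<and>
    (\<forall>ch q S. mixed_stopping T atom ch \<and> (q, S) \<in> Pd_j T atom rate ch j \<longrightarrow>
      exp_payoff T q ch \<xi> S \<le> ask_price T atom rate \<xi> j)"
proof -
  have upper: "exp_payoff T q ch \<xi> S \<le> ask_price T atom rate \<xi> j"
    if "mixed_stopping T atom ch" "(q, S) \<in> Pd_j T atom rate ch j" for ch q S
    unfolding ask_price_def
    using weak_duality[OF _ that] hedge_of_ask_price_set
    by (intro cInf_greatest[OF ask_price_set_nonempty]) blast
  obtain ch q S where "mixed_stopping T atom ch" "(q, S) \<in> Pd_j T atom rate ch j"
    "ask_price T atom rate \<xi> j \<le> exp_payoff T q ch \<xi> S"
    using strong_duality by blast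
  with upper show ?thesis
    by (meson order_antisym)
qed

end

text \<open>Nonemptiness and boundedness below are included because \<open>Inf\<close> is total on
  the reals and is a genuine infimum only under these conditions.\<close>

theorem theorem4p10:
  fixes T :: nat
    and atom :: "nat \<Rightarrow> 'w::finite \<Rightarrow> 'w set"
    and rate :: "nat \<Rightarrow> 'w \<Rightarrow> 'd::finite \<Rightarrow> 'd \<Rightarrow> real"
    and \<xi> :: "nat \<Rightarrow> 'w \<Rightarrow> real^'d"
    and j :: 'd
  assumes "filtration T atom"
    and "exchange_rates T atom rate"
    and "no_arbitrage T atom rate"
    and "adapted T atom \<xi>"
  shows "ask_price_set T atom rate \<xi> j \<noteq> {} \<and> bdd_below (ask_price_set T atom rate \<xi> j) \<and>
    (\<exists>chh qh Sh. mixed_stopping T atom chh \<and> (qh, Sh) \<in> Pd_j T atom rate chh j \<and>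
        ask_price T atom rate \<xi> j = exp_payoff T qh chh \<xi> Sh \<and>
        (\<forall>ch q S. mixed_stopping T atom ch \<and> (q, S) \<in> Pd_j T atom rate ch j \<longrightarrow>
            exp_payoff T q ch \<xi> S \<le> ask_price T atom rate \<xi> j))"
proof -
  interpret american_option T atom rate \<xi> j
    using assms by unfold_locales
  show ?thesis
    using ask_price_set_nonempty ask_price_set_bdd_below ask_price_duality by blast
qed

end
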